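(* If $H$ is a connected graph such that $\{H,H\}$ is unavoidable in $\mathcal{K}_{\mathrm{MP}}$, then $H$ is either a tree on at most four vertices, the path $P_5$, or the fork graph $S_{2,1,1}$.
   Context: All graphs are finite and simple; copies of graphs are subgraphs, not necessarily induced. A graph is maximal planar if it is planar and adding any edge between two non-adjacent vertices destroys planarity; $\mathcal{K}_{\mathrm{MP}}$ is the class of all maximal planar graphs. A pair $\{H,F\}$ is unavoidable in a class $\mathcal{K}$ if there exists $N$ such that for every $G\in\mathcal{K}$ of order at least $N$, every colouring of the edges of $G$ with red and blue contains a red copy of $H$ or a blue copy of $F$. $P_5$ is the path on 5 vertices. The fork $S_{2,1,1}$ is the tree on 5 vertices obtained from $K_{1,3}$ by subdividing one edge once. *)

theory Defs
  imports "HOL-Analysis.Analysis"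
begin

section \<open>Finite simple graphs\<close>

record 'a ugraph =
  verts :: "'a set"
  edges :: "'a set set"

definition simple_graph :: "'a ugraph \<Rightarrow> bool" where
  "simple_graph G \<longleftrightarrow> finite (verts G) \<and> (\<forall>e\<in>edges G. e \<subseteq> verts G \<and> card e = 2)"

definition adj_rel :: "'a ugraph \<Rightarrow> ('a \<times> 'a) set" where
  "adj_rel G = {(u, v). {u, v} \<in> edges G}"

text \<open>The graph without vertices does not count as connected.\<close>

definition connected_graph :: "'a ugraph \<Rightarrow> bool" where
  "connected_graph G \<longleftrightarrow>
     verts G \<noteq> {} \<and> (\<forall>u\<in>verts G. \<forall>v\<in>verts G. (u, v) \<in> (adj_rel G)\<^sup>*)"

definition is_cycle :: "'a ugraph \<Rightarrow> 'a list \<Rightarrow> bool" where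
  "is_cycle G c \<longleftrightarrow> length c \<ge> 3 \<and> distinct c \<and>
     (\<forall>i<length c. {c ! i, c ! (Suc i mod length c)} \<in> edges G)"

definition is_tree :: "'a ugraph \<Rightarrow> bool" where
  "is_tree G \<longleftrightarrow> simple_graph G \<and> connected_graph G \<and> (\<nexists>c. is_cycle G c)"

definition graph_iso :: "'a ugraph \<Rightarrow> 'b ugraph \<Rightarrow> bool" where
  "graph_iso G H \<longleftrightarrow>
     (\<exists>f. bij_betw f (verts G) (verts H) \<and> edges H = (\<lambda>e. f ` e) ` edges G)"

text \<open>Copies are subgraphs that need not be induced.\<close>

definition contains_copy :: "'a ugraph \<Rightarrow> 'b ugraph \<Rightarrow> bool" where
  "contains_copy G H \<longleftrightarrow>
     (\<exists>f. inj_on f (verts H) \<and> f ` verts H \<subseteq> verts G \<and> (\<forall>e\<in>edges H. f ` e \<in> edges G))"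

definition path_graph :: "nat \<Rightarrow> nat ugraph" where
  "path_graph n = \<lparr>verts = {..<n}, edges = {{i, Suc i} | i. Suc i < n}\<rparr>"

text \<open>
  The fork: the star with centre \<open>0\<close> and leaves \<open>1\<close>, \<open>2\<close>, \<open>4\<close>, whose edge from
  \<open>0\<close> to \<open>4\<close> is subdivided by the new vertex \<open>3\<close>.
\<close>

definition fork_graph :: "nat ugraph" where
  "fork_graph = \<lparr>verts = {0, 1, 2, 3, 4}, edges = {{0, 1}, {0, 2}, {0, 3}, {3, 4}}\<rparr>"


section \<open>Planarity\<close>

text \<open>
  A drawing in the plane, represented by the complex numbers: the map \<open>p\<close> places the
  vertices at distinct points, and each edge \<open>e\<close> is drawn as an arc \<open>\<gamma> e\<close> between the points of
  its two ends. An arc meets no vertex other than its ends, and two different arcs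
  meet at most in the points of common ends.
\<close>

definition plane_drawing :: "'a ugraph \<Rightarrow> ('a \<Rightarrow> complex) \<Rightarrow> ('a set \<Rightarrow> real \<Rightarrow> complex) \<Rightarrow> bool" where
  "plane_drawing G p \<gamma> \<longleftrightarrow>
     inj_on p (verts G) \<and>
     (\<forall>e\<in>edges G. arc (\<gamma> e) \<and> {pathstart (\<gamma> e), pathfinish (\<gamma> e)} = p ` e \<and>
                   path_image (\<gamma> e) \<inter> p ` verts G = p ` e) \<and>
     (\<forall>e\<in>edges G. \<forall>f\<in>edges G. e \<noteq> f \<longrightarrow>
                   path_image (\<gamma> e) \<inter> path_image (\<gamma> f) \<subseteq> p ` (e \<inter> f))"

definition planar :: "'a ugraph \<Rightarrow> bool" where
  "planar G \<longleftrightarrow> (\<exists>p \<gamma>. plane_drawing G p \<gamma>)"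

definition add_edge :: "'a \<Rightarrow> 'a \<Rightarrow> 'a ugraph \<Rightarrow> 'a ugraph" where
  "add_edge u v G = \<lparr>verts = verts G, edges = insert {u, v} (edges G)\<rparr>"

definition maximal_planar :: "'a ugraph \<Rightarrow> bool" where
  "maximal_planar G \<longleftrightarrow> simple_graph G \<and> planar G \<and>
     (\<forall>u\<in>verts G. \<forall>v\<in>verts G. u \<noteq> v \<and> {u, v} \<notin> edges G \<longrightarrow> \<not> planar (add_edge u v G))"

text \<open>
  Vertices are natural numbers: every finite graph is isomorphic to a graph of this
  kind, and maximal planarity and unavoidability are invariant under isomorphism.
\<close>

definition maximal_planar_graphs :: "nat ugraph set" where
  "maximal_planar_graphs = {G. maximal_planar G}"


section \<open>Unavoidable pairs\<close>

datatype colour = Red | Blue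

definition colour_subgraph :: "'a ugraph \<Rightarrow> ('a set \<Rightarrow> colour) \<Rightarrow> colour \<Rightarrow> 'a ugraph" where
  "colour_subgraph G c k = \<lparr>verts = verts G, edges = {e \<in> edges G. c e = k}\<rparr>"

definition unavoidable_pair :: "'b ugraph \<Rightarrow> 'c ugraph \<Rightarrow> 'a ugraph set \<Rightarrow> bool" where
  "unavoidable_pair H F K \<longleftrightarrow>
     (\<exists>N. \<forall>G\<in>K. card (verts G) \<ge> N \<longrightarrow>
        (\<forall>c. contains_copy (colour_subgraph G c Red) H \<or>
             contains_copy (colour_subgraph G c Blue) F))"

end

theory Submission
  imports Defs
begin

text \<open>
Three colourings of large maximal planar graphs leave no room for other graphs \<open>H\<close>. Two of them
colour the join of an edge \<open>xy\<close> and a long path \<open>P\<close>.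

\<^item> Colour red the edges between \<open>{x, y}\<close> and \<open>P\<close>, and the others blue. Red is a complete bipartite
  graph with a side of size two, and blue consists of two disjoint paths. So \<open>H\<close> has a
  bipartition with a side of at most two vertices, or \<open>H\<close> is a path
  (\<open>unavoidable_biclique_or_path\<close>).

\<^item> Colour red all edges at \<open>x\<close>, blue all other edges at \<open>y\<close>, and let the colours alternate along
  \<open>P\<close>. The edges of one colour that avoid \<open>x\<close> (for red) or \<open>y\<close> (for blue) form a matching. So
  there is a \<open>z\<close> such that of any two edges of \<open>H\<close> with a common end at least one contains \<open>z\<close>
  (\<open>unavoidable_matching_plus_vertex\<close>).

\<^item> In the cube of a long path all degrees are at most six, and the edges can be coloured so that
  no vertex has more than three edges of one colour. So \<open>H\<close> has maximum degree at most three
  (\<open>unavoidable_max_degree\<close>).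

The second condition forces every cycle to be a triangle, and the first one excludes odd cycles,
so \<open>H\<close> is a tree. Suppose that it has at least five vertices. A path with six vertices violates the
second condition, so if \<open>H\<close> is a path, it is \<open>P\<^sub>5\<close>. Otherwise \<open>H\<close> has a side \<open>{x, y}\<close>, where \<open>x\<close> and
\<open>y\<close> have exactly one common neighbour; a count that uses the other two conditions
leaves \<open>P\<^sub>5\<close> and the fork (\<open>path5_or_fork_of_biclique\<close>).

It remains to see that both families of graphs are maximal planar. Each of them arises from a
triangle when new vertices are placed one at a time inside a face created by the preceding step
and joined to its three corners. Placing each vertex at the centroid of its face gives a drawing with
straight edges (\<open>straight_drawing_stack\<close>). If \<open>u < v\<close> are not adjacent, then \<open>u\<close> was a corner of the
current face until some vertex \<open>k < v\<close> replaced it. At that moment \<open>u\<close>, \<open>k\<close> and the two other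
corners span a \<open>K\<^sub>4\<close>, and the later vertices \<open>k + 1, \<dots>, v\<close> form a connected set joined to \<open>k\<close> and
to these two corners. The new edge \<open>uv\<close> joins it to \<open>u\<close> as well, which yields a \<open>K\<^sub>5\<close> minor. That no
plane graph contains this configuration is the topological core of the argument
(\<open>no_connected_set_touching_K4_corners\<close>): a connected set off a drawing of \<open>K\<^sub>4\<close> cannot have all
four corners in its closure. The proof derives from Janiszewski's theorem and the Jordan curve
theorem how theta curves divide the plane.
\<close>

section \<open>Arcs, theta curves and drawings of \<open>K\<^sub>4\<close>\<close>

text \<open>
Arcs enter only through their point sets: then concatenation is union, and the direction of travel
does not matter.
\<close>

definition arc_between :: "complex set \<Rightarrow> complex \<Rightarrow> complex \<Rightarrow> bool" where
  "arc_between A a b \<longleftrightarrow>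
     (\<exists>g. arc g \<and> path_image g = A \<and> pathstart g = a \<and> pathfinish g = b)"

lemma arc_between_commute: "arc_between A a b \<Longrightarrow> arc_between A b a"
  unfolding arc_between_def
  by (metis arc_reversepath path_image_reversepath pathfinish_reversepath pathstart_reversepath)

lemma arc_between_ends: "arc_between A a b \<Longrightarrow> a \<in> A \<and> b \<in> A \<and> a \<noteq> b"
  unfolding arc_between_def using arc_distinct_ends by blast

lemma arc_between_compact: "arc_between A a b \<Longrightarrow> compact A"
  unfolding arc_between_def by (auto simp: arc_imp_path)

lemma arc_between_connected: "arc_between A a b \<Longrightarrow> connected A"
  unfolding arc_between_def by (auto simp: arc_imp_path)

lemma arc_between_join:
  assumes "arc_between A a b" "arc_between B b c" "A \<inter> B = {b}"
  shows "arc_between (A \<union> B) a c"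
proof -
  obtain g h where g: "arc g" "path_image g = A" "pathstart g = a" "pathfinish g = b"
    and h: "arc h" "path_image h = B" "pathstart h = b" "pathfinish h = c"
    using assms unfolding arc_between_def by blast
  have "arc (g +++ h)"
    using g h assms(3) by (intro arc_join) auto
  moreover have "path_image (g +++ h) = A \<union> B"
    using g h by (simp add: path_image_join)
  ultimately show ?thesis
    unfolding arc_between_def using g h by (metis pathfinish_join pathstart_join)
qed

lemma arc_between_interior_connected: "arc_between A a b \<Longrightarrow> connected (A - {a, b})"
  unfolding arc_between_def using arc_imp_simple_path connected_simple_path_endless by blast

lemma arc_between_subset_closure_interior:
  assumes "arc_between A a b"
  shows "A \<subseteq> closure (A - {a, b})"
proof -
  obtain g where g: "arc g" "path_image g = A" "pathstart g = a" "pathfinish g = b"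
    using assms unfolding arc_between_def by blast
  have eq: "A - {a, b} = g ` {0<..<1}"
    using simple_path_endless[of g] g arc_imp_simple_path by blast
  have "g ` closure {0<..<1} \<subseteq> closure (A - {a, b})"
  proof (rule image_closure_subset)
    show "continuous_on (closure {0<..<1}) g"
      using g(1) by (simp add: arc_def path_def)
    show "g ` {0<..<1} \<subseteq> closure (A - {a, b})"
      unfolding eq by (rule closure_subset)
  qed simp
  then show ?thesis
    using g(2) by (simp add: path_image_def)
qed

lemma arc_between_interior_nonempty:
  assumes "arc_between A a b"
  shows "A - {a, b} \<noteq> {}"
  using arc_between_subset_closure_interior[OF assms] arc_between_ends[OF assms]
  by (metis closure_empty empty_iff subset_empty)

lemma arc_between_minus_ends_connected:
  assumes "arc_between A a b"
  shows "connected (A - {a})" "connected (A - {b})"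
  by (rule connected_intermediate_closure[OF arc_between_interior_connected[OF assms]];
      use arc_between_subset_closure_interior[OF assms] in blast)+

text \<open>
The Jordan curve theorem without reference to inside and outside. The arguments below treat the
two sides alike, and a drawing may put any face outside.
\<close>

lemma other_side_of_closed_curve:
  assumes A: "arc_between A a b" and B: "arc_between B a b" and AB: "A \<inter> B = {a, b}"
    and e: "e \<notin> A \<union> B"
  obtains U where "U \<noteq> {}" "connected U" "frontier U = A \<union> B"
    "U \<union> connected_component_set (- (A \<union> B)) e = - (A \<union> B)"
    "U \<inter> connected_component_set (- (A \<union> B)) e = {}"
proof -
  obtain g h where g: "arc g" "path_image g = A" "pathstart g = a" "pathfinish g = b"
    and h: "arc h" "path_image h = B" "pathstart h = b" "pathfinish h = a"
    using A arc_between_commute[OF B] unfolding arc_between_def by blast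
  have "simple_path (g +++ h)"
    using g h AB by (intro simple_path_join_loop) auto
  moreover have "pathfinish (g +++ h) = pathstart (g +++ h)"
    using g h by simp
  moreover have img: "path_image (g +++ h) = A \<union> B"
    using g h by (simp add: path_image_join)
  ultimately have J: "inside (A \<union> B) \<noteq> {}" "connected (inside (A \<union> B))"
    "outside (A \<union> B) \<noteq> {}" "connected (outside (A \<union> B))"
    "frontier (inside (A \<union> B)) = A \<union> B" "frontier (outside (A \<union> B)) = A \<union> B"
    using Jordan_inside_outside[of "g +++ h"] by auto
  have comp: "connected_component_set (- (A \<union> B)) e = V"
    if V: "connected V" "frontier V = A \<union> B" "e \<in> V" "V \<subseteq> - (A \<union> B)" for V
  proof
    show "V \<subseteq> connected_component_set (- (A \<union> B)) e"
      using V by (simp add: connected_component_maximal)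
    show "connected_component_set (- (A \<union> B)) e \<subseteq> V"
    proof (rule ccontr)
      assume "\<not> ?thesis"
      moreover have "e \<in> connected_component_set (- (A \<union> B)) e \<inter> V"
        using V e by simp
      ultimately have "connected_component_set (- (A \<union> B)) e \<inter> frontier V \<noteq> {}"
        by (intro connected_Int_frontier) (blast intro: connected_connected_component)+
      then show False
        using connected_component_subset[of "- (A \<union> B)" e] V(2) by blast
    qed
  qed
  show ?thesis
  proof (cases "e \<in> inside (A \<union> B)")
    case True
    then have "connected_component_set (- (A \<union> B)) e = inside (A \<union> B)"
      using J comp[of "inside (A \<union> B)"] inside_no_overlap by blast
    then show ?thesis
      using that[of "outside (A \<union> B)"] J inside_Un_outside[of "A \<union> B"]
        inside_Int_outside[of "A \<union> B"] by (simp add: Un_commute Int_commute)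
  next
    case False
    then have "e \<in> outside (A \<union> B)"
      using e inside_Un_outside by blast
    then have "connected_component_set (- (A \<union> B)) e = outside (A \<union> B)"
      using J comp[of "outside (A \<union> B)"] outside_no_overlap by blast
    then show ?thesis
      using that[of "inside (A \<union> B)"] J inside_Un_outside[of "A \<union> B"]
        inside_Int_outside[of "A \<union> B"] by simp
  qed
qed

lemma connected_component_closure_point:
  assumes "connected E" "e \<in> E" "d \<in> closure E" "E \<subseteq> S" "d \<in> S"
  shows "connected_component S e d"
proof -
  have "connected (insert d E)"
    by (rule connected_intermediate_closure[OF assms(1)]) (use assms closure_subset in auto)
  then show ?thesis
    unfolding connected_component_def using assms by blast
qed

text \<open>
Of the three faces of a theta curve, the one that contains \<open>E\<close> is bounded by \<open>A1\<close> and \<open>A2\<close>, because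
\<open>E\<close> accumulates at an interior point of each; so the closed curve \<open>A1 \<union> A2\<close> separates it
from \<open>A0\<close>. For the proof, suppose that \<open>E\<close> and \<open>A0\<close> lie on the same side. For each of the three closed
curves consider the side that does not contain \<open>E\<close>. None of these three regions meets the theta curve,
and no two share a point, as their frontiers differ. Hence a point of the
region belonging to \<open>A0 \<union> A1\<close> is separated from \<open>E\<close> by neither of the other two curves. These two
meet in the connected set \<open>A2\<close>, so by Janiszewski's theorem their union, the whole theta curve, does not
separate the point from \<open>E\<close> either, although \<open>A0 \<union> A1\<close> does.
\<close>

lemma theta_curve_face:
  assumes A: "arc_between A0 a b" "arc_between A1 a b" "arc_between A2 a b"
    and I: "A0 \<inter> A1 = {a, b}" "A0 \<inter> A2 = {a, b}" "A1 \<inter> A2 = {a, b}"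
    and E: "connected E" "E \<inter> (A0 \<union> A1 \<union> A2) = {}" "e \<in> E"
    and c: "c \<in> A1 - {a, b}" "c \<in> closure E"
    and d: "d \<in> A2 - {a, b}" "d \<in> closure E"
    and q: "q \<in> A0 - {a, b}"
  shows "\<not> connected_component (- (A1 \<union> A2)) e q"
proof
  assume eq: "connected_component (- (A1 \<union> A2)) e q"
  have e: "e \<notin> A0" "e \<notin> A1" "e \<notin> A2"
    using E by auto
  obtain U0 where U0: "U0 \<noteq> {}" "connected U0" "frontier U0 = A1 \<union> A2"
    "U0 \<union> connected_component_set (- (A1 \<union> A2)) e = - (A1 \<union> A2)"
    "U0 \<inter> connected_component_set (- (A1 \<union> A2)) e = {}"
    using other_side_of_closed_curve[OF A(2,3) I(3)] e by blast
  obtain U1 where U1: "U1 \<noteq> {}" "connected U1" "frontier U1 = A0 \<union> A1"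
    "U1 \<union> connected_component_set (- (A0 \<union> A1)) e = - (A0 \<union> A1)"
    "U1 \<inter> connected_component_set (- (A0 \<union> A1)) e = {}"
    using other_side_of_closed_curve[OF A(1,2) I(1)] e by blast
  obtain U2 where U2: "U2 \<noteq> {}" "connected U2" "frontier U2 = A0 \<union> A2"
    "U2 \<union> connected_component_set (- (A0 \<union> A2)) e = - (A0 \<union> A2)"
    "U2 \<inter> connected_component_set (- (A0 \<union> A2)) e = {}"
    using other_side_of_closed_curve[OF A(1,3) I(2)] e by blast
  have spread: "connected_component S e y"
    if "arc_between X a b" "connected_component S e x" "x \<in> X - {a, b}" "X - {a, b} \<subseteq> S"
      "y \<in> X - {a, b}" for X S x y
  proof -
    have "connected_component S x y"
      unfolding connected_component_def
      using arc_between_interior_connected[OF that(1)] that by blast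
    then show ?thesis
      using that(2) connected_component_trans by blast
  qed
  (* The interior of A2 lies on the same side of A0 \<union> A1 as E, because E
     accumulates at the point d of A2; the same holds for A1 and A0 \<union> A2. *)
  have "connected_component (- (A0 \<union> A1)) e d"
    by (rule connected_component_closure_point[OF E(1,3) d(2)]) (use E d I in blast)+
  then have "connected_component (- (A0 \<union> A1)) e y" if "y \<in> A2 - {a, b}" for y
    using spread[OF A(3), of "- (A0 \<union> A1)" d y] d that I by blast
  then have U1A2: "U1 \<inter> A2 = {}"
    using U1(4,5) arc_between_ends[OF A(1)] by blast
  have "connected_component (- (A0 \<union> A2)) e c"
    by (rule connected_component_closure_point[OF E(1,3) c(2)]) (use E c I in blast)+
  then have "connected_component (- (A0 \<union> A2)) e y" if "y \<in> A1 - {a, b}" for y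
    using spread[OF A(2), of "- (A0 \<union> A2)" c y] c that I by blast
  then have U2A1: "U2 \<inter> A1 = {}"
    using U2(4,5) arc_between_ends[OF A(1)] by blast
  have "connected_component (- (A1 \<union> A2)) e y" if "y \<in> A0 - {a, b}" for y
    using spread[OF A(1) eq q _ that] I by blast
  then have U0A0: "U0 \<inter> A0 = {}"
    using U0(4,5) arc_between_ends[OF A(2)] by blast
  obtain p where p: "p \<in> U1"
    using U1 by blast
  (* Two connected regions with a common point coincide if neither meets the
     frontier of the other; but frontiers of different closed curves differ. *)
  have same: "X = Y" if "connected X" "connected Y" "p \<in> X" "p \<in> Y"
    "X \<inter> frontier Y = {}" "Y \<inter> frontier X = {}" for X Y :: "complex set"
    using connected_Int_frontier[of X Y] connected_Int_frontier[of Y X] that by blast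
  have d': "d \<notin> A0 \<union> A1"
    using d I by blast
  have sub: "U0 \<subseteq> - (A1 \<union> A2)" "U1 \<subseteq> - (A0 \<union> A1)" "U2 \<subseteq> - (A0 \<union> A2)"
    using U0(4) U1(4) U2(4) by auto
  have "p \<notin> U2"
  proof
    assume "p \<in> U2"
    then have "U1 = U2"
      using sub U1A2 U2A1 by (intro same[OF U1(2) U2(2) p]) (auto simp: U1(3) U2(3))
    then show False
      using U1(3) U2(3) d d' by auto
  qed
  then have p2: "connected_component (- (A0 \<union> A2)) e p"
  proof -
    have "p \<in> - (A0 \<union> A2)"
      using p U1(4) U1A2 by auto
    then show ?thesis
      using U2(4) \<open>p \<notin> U2\<close> by (metis UnE mem_Collect_eq)
  qed
  have "p \<notin> U0"
  proof
    assume "p \<in> U0"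
    then have "U1 = U0"
      using sub U1A2 U0A0 by (intro same[OF U1(2) U0(2) p]) (auto simp: U1(3) U0(3))
    then show False
      using U1(3) U0(3) d d' by auto
  qed
  then have p0: "connected_component (- (A1 \<union> A2)) e p"
  proof -
    have "p \<in> - (A1 \<union> A2)"
      using p U1(4) U1A2 by auto
    then show ?thesis
      using U0(4) \<open>p \<notin> U0\<close> by (metis UnE mem_Collect_eq)
  qed
  (* Neither of the two closed curves through A2 separates e from p. *)
  have "(A0 \<union> A2) \<inter> (A1 \<union> A2) = A2"
    using I arc_between_ends[OF A(3)] by blast
  then have "connected_component (- ((A0 \<union> A2) \<union> (A1 \<union> A2))) e p"
    using A[THEN arc_between_compact] A(3)[THEN arc_between_connected]
    by (intro Janiszewski[OF _ _ _ p2 p0]) (simp_all add: compact_Un compact_imp_closed)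
  then have "connected_component (- (A0 \<union> A1)) e p"
    by (rule connected_component_of_subset) blast
  then show False
    using U1(5) p by blast
qed

lemma two_sides_of_closed_curve:
  assumes "arc_between A a b" "arc_between B a b" "A \<inter> B = {a, b}"
    and "x \<notin> A \<union> B" "y \<notin> A \<union> B" "z \<notin> A \<union> B"
    and "\<not> connected_component (- (A \<union> B)) x y" "\<not> connected_component (- (A \<union> B)) x z"
  shows "connected_component (- (A \<union> B)) y z"
proof -
  obtain U where U: "connected U"
    "U \<union> connected_component_set (- (A \<union> B)) x = - (A \<union> B)"
    using other_side_of_closed_curve[OF assms(1-4)] by metis
  then have "y \<in> U" "z \<in> U" "U \<subseteq> - (A \<union> B)"
    using assms by auto
  then show ?thesis
    unfolding connected_component_def using U by blast
qed

lemma plane_drawing_arc: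
  assumes "plane_drawing G p \<gamma>" "{u, v} \<in> edges G"
  shows "arc_between (path_image (\<gamma> {u, v})) (p u) (p v)"
proof -
  have g: "arc (\<gamma> {u, v})" "{pathstart (\<gamma> {u, v}), pathfinish (\<gamma> {u, v})} = {p u, p v}"
    using assms unfolding plane_drawing_def by auto
  then have "arc_between (path_image (\<gamma> {u, v})) (pathstart (\<gamma> {u, v})) (pathfinish (\<gamma> {u, v}))"
    unfolding arc_between_def by blast
  with g(2) show ?thesis
    using arc_between_commute by (metis doubleton_eq_iff)
qed

lemma plane_drawing_edges_Int:
  assumes "plane_drawing G p \<gamma>" "e \<in> edges G" "f \<in> edges G" "e \<noteq> f"
  shows "path_image (\<gamma> e) \<inter> path_image (\<gamma> f) = p ` (e \<inter> f)"
proof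
  show "path_image (\<gamma> e) \<inter> path_image (\<gamma> f) \<subseteq> p ` (e \<inter> f)"
    using assms unfolding plane_drawing_def by blast
  have "p ` e \<subseteq> path_image (\<gamma> e)" "p ` f \<subseteq> path_image (\<gamma> f)"
    using assms unfolding plane_drawing_def by blast+
  then show "p ` (e \<inter> f) \<subseteq> path_image (\<gamma> e) \<inter> path_image (\<gamma> f)"
    by blast
qed

text \<open>
The cycle \<open>acbd\<close> has only two sides, yet three things would lie on pairwise different sides of it: the
set \<open>E\<close>, the chord \<open>ab\<close> and the chord \<open>cd\<close>. All three separations are instances of
\<open>theta_curve_face\<close>: add the chord \<open>ab\<close> to the cycle and take \<open>E\<close>, or the interior of \<open>cd\<close>, as the
connected set; then add the chord \<open>cd\<close> and take \<open>E\<close>.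
\<close>

lemma no_connected_set_touching_K4_corners:
  assumes D: "plane_drawing G p \<gamma>"
    and dist: "distinct [a, b, c, d]"
    and K4: "{a, b} \<in> edges G" "{a, c} \<in> edges G" "{a, d} \<in> edges G"
      "{b, c} \<in> edges G" "{b, d} \<in> edges G" "{c, d} \<in> edges G"
    and V: "{a, b, c, d} \<subseteq> verts G"
    and E: "connected E" "E \<noteq> {}"
      "\<And>e. e \<in> edges G \<Longrightarrow> e \<subseteq> {a, b, c, d} \<Longrightarrow> E \<inter> path_image (\<gamma> e) = {}"
    and corners: "p ` {a, b, c, d} \<subseteq> closure E"
  shows False
proof -
  define P where "P u v = path_image (\<gamma> {u, v})" for u v
  define K where "K = {a, b, c, d}"
  have inK: "a \<in> K" "b \<in> K" "c \<in> K" "d \<in> K"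
    by (simp_all add: K_def)
  have sym: "P u v = P v u" for u v
    by (simp add: P_def insert_commute)
  have edge: "{u, v} \<in> edges G" if "u \<in> K" "v \<in> K" "u \<noteq> v" for u v
    using that K4 by (auto simp: insert_commute K_def)
  have arc: "arc_between (P u v) (p u) (p v)" if "u \<in> K" "v \<in> K" "u \<noteq> v" for u v
    unfolding P_def using plane_drawing_arc[OF D] edge that by blast
  have inj: "p u \<noteq> p v" if "u \<in> K" "v \<in> K" "u \<noteq> v" for u v
  proof -
    have "inj_on p (verts G)"
      using D unfolding plane_drawing_def by simp
    then show ?thesis
      using V that by (metis K_def inj_onD subsetD)
  qed
  have at_end: "P u v \<inter> P u w = {p u}" if "u \<in> K" "v \<in> K" "w \<in> K" "distinct [u, v, w]" for u v w
  proof -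
    have "P u v \<inter> P u w = p ` ({u, v} \<inter> {u, w})"
      unfolding P_def using that
      by (intro plane_drawing_edges_Int[OF D] edge) (auto simp: doubleton_eq_iff)
    also have "{u, v} \<inter> {u, w} = {u}"
      using that by auto
    finally show ?thesis
      by simp
  qed
  have apart: "P u v \<inter> P w x = {}"
    if "u \<in> K" "v \<in> K" "w \<in> K" "x \<in> K" "distinct [u, v, w, x]" for u v w x
  proof -
    have "P u v \<inter> P w x = p ` ({u, v} \<inter> {w, x})"
      unfolding P_def using that
      by (intro plane_drawing_edges_Int[OF D] edge) (auto simp: doubleton_eq_iff)
    also have "{u, v} \<inter> {w, x} = {}"
      using that by auto
    finally show ?thesis
      by simp
  qed
  have EP: "E \<inter> P u v = {}" if "u \<in> K" "v \<in> K" "u \<noteq> v" for u v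
    unfolding P_def using that edge by (intro E(3)) (auto simp: K_def)
  have ends: "p u \<in> P u v" "p v \<in> P u v" if "u \<in> K" "v \<in> K" "u \<noteq> v" for u v
    using arc_between_ends[OF arc[OF that]] by auto
  have detour: "arc_between (P u w \<union> P w v) (p u) (p v)"
    if "u \<in> K" "v \<in> K" "w \<in> K" "distinct [u, v, w]" for u v w
    using arc[of u w] arc[of w v] at_end[of w u v] that
    by (intro arc_between_join[of _ _ "p w"]) (auto simp: sym)
  have chord: "P u v \<inter> (P u w \<union> P w v) = {p u, p v}"
    if "u \<in> K" "v \<in> K" "w \<in> K" "distinct [u, v, w]" for u v w
    using at_end[of u v w] at_end[of v u w] that sym[of v u] sym[of v w] by auto
  have detours: "(P u w \<union> P w v) \<inter> (P u x \<union> P x v) = {p u, p v}"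
    if "u \<in> K" "v \<in> K" "w \<in> K" "x \<in> K" "distinct [u, v, w, x]" for u v w x
    using at_end[of u w x] at_end[of v w x] apart[of u w x v] apart[of w v u x] that
      sym[of v w] sym[of v x] by (auto simp: Int_Un_distrib Int_Un_distrib2)
  have separated: "\<not> connected_component (- ((P u w \<union> P w v) \<union> (P u x \<union> P x v))) f q"
    if uv: "u \<in> K" "v \<in> K" "w \<in> K" "x \<in> K" "distinct [u, v, w, x]"
      and F: "connected F" "f \<in> F"
        "F \<inter> P u v = {}" "F \<inter> P u w = {}" "F \<inter> P w v = {}" "F \<inter> P u x = {}" "F \<inter> P x v = {}"
        "p w \<in> closure F" "p x \<in> closure F"
      and q: "q \<in> P u v - {p u, p v}" for u v w x F f q
  proof (rule theta_curve_face[OF _ _ _ _ _ _ F(1) _ F(2) _ F(8) _ F(9) q])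
    show "F \<inter> (P u v \<union> (P u w \<union> P w v) \<union> (P u x \<union> P x v)) = {}"
      using F by (simp add: Int_Un_distrib)
    show "p w \<in> P u w \<union> P w v - {p u, p v}" "p x \<in> P u x \<union> P x v - {p u, p v}"
      using uv ends[of u w] ends[of u x] inj[of w] inj[of x] by auto
  qed (use uv arc detour chord detours in auto)
  have dist': "a \<noteq> b" "a \<noteq> c" "a \<noteq> d" "b \<noteq> c" "b \<noteq> d" "c \<noteq> d"
    using dist by auto
  have corner: "p u \<in> closure E" if "u \<in> K" for u
    using that corners by (auto simp: K_def)
  obtain e where e: "e \<in> E"
    using E by blast
  obtain q where q: "q \<in> P a b - {p a, p b}"
    using arc_between_interior_nonempty[OF arc[of a b]] inK dist' by auto
  obtain r where r: "r \<in> P c d - {p c, p d}"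
    using arc_between_interior_nonempty[OF arc[of c d]] inK dist' by auto
  let ?C = "(P a c \<union> P c b) \<union> (P a d \<union> P d b)"
  have 1: "\<not> connected_component (- ?C) e q"
    using inK dist by (intro separated[OF _ _ _ _ _ E(1) e _ _ _ _ _ _ _ q] EP corner) auto
  have 2: "\<not> connected_component (- ?C) r q"
  proof (rule separated[OF _ _ _ _ _ _ r _ _ _ _ _ _ _ q])
    show "connected (P c d - {p c, p d})"
      using arc[of c d] arc_between_interior_connected inK dist by auto
    show "p c \<in> closure (P c d - {p c, p d})" "p d \<in> closure (P c d - {p c, p d})"
      using arc_between_subset_closure_interior[OF arc[of c d]] ends[of c d] inK dist by auto
    show "(P c d - {p c, p d}) \<inter> P a b = {}"
      using apart[of c d a b] inK dist by auto
    show "(P c d - {p c, p d}) \<inter> P a c = {}" "(P c d - {p c, p d}) \<inter> P c b = {}"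
      using at_end[of c d a] at_end[of c d b] inK dist sym[of a c] by auto
    show "(P c d - {p c, p d}) \<inter> P a d = {}" "(P c d - {p c, p d}) \<inter> P d b = {}"
      using at_end[of d c a] at_end[of d c b] inK dist sym[of a d] sym[of d c] by auto
  qed (use inK dist in auto)
  have "\<not> connected_component (- ((P c a \<union> P a d) \<union> (P c b \<union> P b d))) e r"
    using inK dist by (intro separated[OF _ _ _ _ _ E(1) e _ _ _ _ _ _ _ r] EP corner) auto
  moreover have "(P c a \<union> P a d) \<union> (P c b \<union> P b d) = ?C"
    using sym[of c a] sym[of b d] by blast
  ultimately have 3: "\<not> connected_component (- ?C) e r"
    by simp
  have "e \<notin> ?C"
    using e EP[of a c] EP[of c b] EP[of a d] EP[of d b] inK dist' by blast
  moreover have "q \<notin> ?C"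
    using q chord[of a b c] chord[of a b d] inK dist by auto
  moreover have "r \<notin> ?C"
    using r chord[of c d a] chord[of c d b] inK dist sym[of c a] sym[of b d] by auto
  ultimately have "connected_component (- ?C) q r"
    using detour[of a b c] detour[of a b d] detours[of a b c d] 1 3 inK dist
    by (intro two_sides_of_closed_curve[of _ "p a" "p b" _ e]) auto
  then show False
    using 2 connected_component_sym by metis
qed

section \<open>A forbidden configuration in planar graphs\<close>

text \<open>
Edges that leave \<open>u\<close>, cut off at the corners in \<open>K\<close>, are the pieces from which a connected
set is glued together below.
\<close>

lemma plane_drawing_edge_minus_corners:
  assumes D: "plane_drawing G p \<gamma>" and e: "{u, v} \<in> edges G" "{u, v} \<subseteq> verts G" "u \<noteq> v"
    and K: "K \<subseteq> verts G" "u \<notin> K"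
  shows "connected (path_image (\<gamma> {u, v}) - p ` K)" "p u \<in> path_image (\<gamma> {u, v}) - p ` K"
    "v \<in> K \<Longrightarrow> p v \<in> closure (path_image (\<gamma> {u, v}) - p ` K)"
proof -
  let ?P = "path_image (\<gamma> {u, v})"
  have arc: "arc_between ?P (p u) (p v)"
    using plane_drawing_arc[OF D e(1)] .
  have inj: "inj_on p (verts G)"
    using D by (simp add: plane_drawing_def)
  have "?P \<inter> p ` verts G = p ` {u, v}"
    using D e(1) by (simp add: plane_drawing_def)
  moreover have "?P \<inter> p ` K = ?P \<inter> p ` verts G \<inter> p ` K"
    by (simp add: Int_assoc Int_absorb1[OF image_mono[OF K(1)]])
  ultimately have "?P \<inter> p ` K = p ` {u, v} \<inter> p ` K"
    by simp
  also have "\<dots> = p ` ({u, v} \<inter> K)"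
    using inj e K by (intro inj_on_image_Int[symmetric]) auto
  finally have PK: "?P - p ` K = ?P - p ` ({u, v} \<inter> K)"
    by blast
  have cases: "?P - p ` K = (if v \<in> K then ?P - {p v} else ?P)"
    unfolding PK using K by auto
  show "connected (?P - p ` K)"
    unfolding cases using arc_between_connected[OF arc] arc_between_minus_ends_connected[OF arc] by simp
  show "p u \<in> ?P - p ` K"
    unfolding cases using arc_between_ends[OF arc] by auto
  show "p v \<in> closure (?P - p ` K)" if "v \<in> K"
  proof -
    have "?P - {p u, p v} \<subseteq> ?P - p ` K"
      unfolding cases by auto
    then show ?thesis
      using closure_mono arc_between_subset_closure_interior[OF arc] arc_between_ends[OF arc] by blast
  qed
qed

text \<open>
Four branch sets of this minor are single vertices, so that the edges between them are arcs of the
drawing. The fifth branch set \<open>W\<close> with all its edges, without the four corners, is a connected subset of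
the plane whose closure contains the corners.
\<close>

lemma planar_no_K5_minor:
  assumes G: "simple_graph G" "planar G"
    and K4: "distinct [a, b, c, d]" "{a, b} \<in> edges G" "{a, c} \<in> edges G" "{a, d} \<in> edges G"
      "{b, c} \<in> edges G" "{b, d} \<in> edges G" "{c, d} \<in> edges G"
    and W: "W \<subseteq> verts G" "W \<noteq> {}" "W \<inter> {a, b, c, d} = {}"
    and W_conn: "\<And>u v. u \<in> W \<Longrightarrow> v \<in> W \<Longrightarrow> (u, v) \<in> (adj_rel G \<inter> W \<times> W)\<^sup>*"
    and nbr: "\<And>k. k \<in> {a, b, c, d} \<Longrightarrow> \<exists>w\<in>W. {w, k} \<in> edges G"
  shows False
proof -
  obtain p \<gamma> where D: "plane_drawing G p \<gamma>"
    using G(2) unfolding planar_def by blast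
  define K where "K = {a, b, c, d}"
  have simple: "u \<in> verts G" "v \<in> verts G" "u \<noteq> v" if "{u, v} \<in> edges G" for u v
    using G(1) that unfolding simple_graph_def by fastforce+
  have KV: "K \<subseteq> verts G"
    unfolding K_def using K4 simple by blast
  have WK: "w \<notin> K" if "w \<in> W" for w
    using W(3) that unfolding K_def by blast
  define E where
    "E = (p ` W \<union> (\<Union>e\<in>{e \<in> edges G. e \<inter> W \<noteq> {}}. path_image (\<gamma> e))) - p ` K"
  have inj: "inj_on p (verts G)"
    using D unfolding plane_drawing_def by blast
  have pW: "p w \<in> E" if "w \<in> W" for w
    using that inj WK KV W(1) unfolding E_def by (auto dest: inj_onD)
  have piece: "connected (path_image (\<gamma> {w, v}) - p ` K)"
    "p w \<in> path_image (\<gamma> {w, v}) - p ` K"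
    "v \<in> K \<Longrightarrow> p v \<in> closure (path_image (\<gamma> {w, v}) - p ` K)"
    "path_image (\<gamma> {w, v}) - p ` K \<subseteq> E"
    if "w \<in> W" "{w, v} \<in> edges G" for w v
    using plane_drawing_edge_minus_corners[OF D that(2) _ _ KV WK[OF that(1)]] simple[OF that(2)]
      that unfolding E_def by auto
  have reach: "connected_component E (p u) (p v)" if "(u, v) \<in> (adj_rel G \<inter> W \<times> W)\<^sup>*" "u \<in> W" for u v
    using that
  proof (induction rule: rtrancl_induct)
    case base
    then show ?case
      using pW connected_component_refl by metis
  next
    case (step v w)
    then have vw: "v \<in> W" "w \<in> W" "{v, w} \<in> edges G"
      by (auto simp: adj_rel_def)
    then have "p w \<in> path_image (\<gamma> {v, w}) - p ` K"
      using piece(2)[of w v] by (simp add: insert_commute)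
    then have "connected_component E (p v) (p w)"
      unfolding connected_component_def using piece(1,2,4)[OF vw(1,3)] by blast
    then show ?case
      using step connected_component_trans by metis
  qed
  have to_W: "\<exists>w\<in>W. connected_component E z (p w)" if "z \<in> E" for z
  proof (cases "z \<in> p ` W")
    case True
    then show ?thesis
      using that connected_component_refl by blast
  next
    case False
    then obtain e w where e: "e \<in> edges G" "w \<in> e" "w \<in> W" "z \<in> path_image (\<gamma> e) - p ` K"
      using \<open>z \<in> E\<close> unfolding E_def by blast
    have "card e = 2"
      using G(1) e(1) unfolding simple_graph_def by blast
    then obtain v where v: "e = {w, v}"
      using e(2) by (auto simp: card_2_iff)
    have "connected_component E z (p w)"
      unfolding connected_component_def using piece(1,2,4)[of w v] e v by blast
    then show ?thesis
      using e by blast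
  qed
  have "connected E"
    unfolding connected_iff_connected_component
  proof (intro ballI)
    fix x y
    assume "x \<in> E" "y \<in> E"
    then obtain u v where "u \<in> W" "v \<in> W" "connected_component E x (p u)" "connected_component E y (p v)"
      using to_W by blast
    moreover have "connected_component E (p u) (p v)"
      using reach W_conn calculation by blast
    ultimately show "connected_component E x y"
      by (meson connected_component_sym connected_component_trans)
  qed
  moreover have "E \<noteq> {}"
    using pW W(2) by blast
  moreover have "E \<inter> path_image (\<gamma> e) = {}" if e: "e \<in> edges G" "e \<subseteq> K" for e
  proof -
    have "p ` W \<inter> path_image (\<gamma> e) \<subseteq> p ` K"
    proof -
      have "path_image (\<gamma> e) \<inter> p ` verts G = p ` e"
        using D e unfolding plane_drawing_def by blast
      then show ?thesis
        using W(1) e(2) by blast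
    qed
    moreover have "path_image (\<gamma> f) \<inter> path_image (\<gamma> e) \<subseteq> p ` K"
      if "f \<in> edges G" "f \<inter> W \<noteq> {}" for f
    proof -
      have "f \<noteq> e"
        using that e WK by blast
      then have "path_image (\<gamma> f) \<inter> path_image (\<gamma> e) = p ` (f \<inter> e)"
        using plane_drawing_edges_Int[OF D that(1) e(1)] by blast
      then show ?thesis
        using e(2) by blast
    qed
    ultimately show ?thesis
      unfolding E_def by blast
  qed
  moreover have "p ` K \<subseteq> closure E"
  proof
    fix x
    assume "x \<in> p ` K"
    then obtain k where k: "k \<in> K" "x = p k"
      by blast
    then obtain w where w: "w \<in> W" "{w, k} \<in> edges G"
      using nbr unfolding K_def by blast
    then show "x \<in> closure E"
      using piece(3,4)[OF w] k closure_mono by blast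
  qed
  ultimately show False
    using no_connected_set_touching_K4_corners[OF D K4, of E] KV unfolding K_def by blast
qed

section \<open>Straight-line drawings of stacked triangulations\<close>

text \<open>
Three points that are not collinear. The form in terms of weights is symmetric and is what uniqueness
of barycentric coordinates needs.
\<close>

definition affinely_independent3 :: "complex \<Rightarrow> complex \<Rightarrow> complex \<Rightarrow> bool" where
  "affinely_independent3 A B C \<longleftrightarrow>
     (\<forall>x y z :: real. x + y + z = 0 \<and> x *\<^sub>R A + y *\<^sub>R B + z *\<^sub>R C = 0 \<longrightarrow> x = 0 \<and> y = 0 \<and> z = 0)"

definition open_triangle :: "complex \<Rightarrow> complex \<Rightarrow> complex \<Rightarrow> complex set" where
  "open_triangle A B C =
     {x *\<^sub>R A + y *\<^sub>R B + z *\<^sub>R C | x y z :: real. 0 < x \<and> 0 < y \<and> 0 < z \<and> x + y + z = 1}"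

definition centroid :: "complex \<Rightarrow> complex \<Rightarrow> complex \<Rightarrow> complex" where
  "centroid A B C = (1/3) *\<^sub>R A + (1/3) *\<^sub>R B + (1/3) *\<^sub>R C"

lemma affinely_independent3_perm:
  "affinely_independent3 A B C \<Longrightarrow> affinely_independent3 B C A"
  "affinely_independent3 A B C \<Longrightarrow> affinely_independent3 B A C"
proof -
  assume ind: "affinely_independent3 A B C"
  show "affinely_independent3 B C A"
    unfolding affinely_independent3_def
  proof (intro allI impI)
    fix x y z :: real
    assume "x + y + z = 0 \<and> x *\<^sub>R B + y *\<^sub>R C + z *\<^sub>R A = 0"
    then show "x = 0 \<and> y = 0 \<and> z = 0"
      using ind[unfolded affinely_independent3_def, rule_format, of z x y] by (simp add: add_ac)
  qed
  show "affinely_independent3 B A C"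
    unfolding affinely_independent3_def
  proof (intro allI impI)
    fix x y z :: real
    assume "x + y + z = 0 \<and> x *\<^sub>R B + y *\<^sub>R A + z *\<^sub>R C = 0"
    then show "x = 0 \<and> y = 0 \<and> z = 0"
      using ind[unfolded affinely_independent3_def, rule_format, of y x z] by (simp add: add_ac)
  qed
qed

lemma open_triangle_perm:
  "open_triangle B C A = open_triangle A B C"
  "open_triangle B A C = open_triangle A B C"
proof -
  have cyc: "open_triangle B C A \<subseteq> open_triangle A B C" for A B C
  proof
    fix w
    assume "w \<in> open_triangle B C A"
    then obtain x y z :: real where "0 < x" "0 < y" "0 < z" "x + y + z = 1"
      "w = x *\<^sub>R B + y *\<^sub>R C + z *\<^sub>R A"
      unfolding open_triangle_def by blast
    then show "w \<in> open_triangle A B C"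
      unfolding open_triangle_def
      by (intro CollectI exI[of _ z] exI[of _ x] exI[of _ y]) (simp add: add_ac)
  qed
  have swap: "open_triangle B A C \<subseteq> open_triangle A B C" for A B C
  proof
    fix w
    assume "w \<in> open_triangle B A C"
    then obtain x y z :: real where "0 < x" "0 < y" "0 < z" "x + y + z = 1"
      "w = x *\<^sub>R B + y *\<^sub>R A + z *\<^sub>R C"
      unfolding open_triangle_def by blast
    then show "w \<in> open_triangle A B C"
      unfolding open_triangle_def
      by (intro CollectI exI[of _ y] exI[of _ x] exI[of _ z]) (simp add: add_ac)
  qed
  show "open_triangle B C A = open_triangle A B C" "open_triangle B A C = open_triangle A B C"
    using cyc swap by (metis subset_antisym)+
qed

lemma centroid_perm: "centroid B C A = centroid A B C" "centroid B A C = centroid A B C"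
  unfolding centroid_def by (simp_all add: add_ac)

lemma barycentric_unique:
  assumes "affinely_independent3 A B C"
    and "x *\<^sub>R A + y *\<^sub>R B + z *\<^sub>R C = x' *\<^sub>R A + y' *\<^sub>R B + z' *\<^sub>R C"
    and "x + y + z = x' + y' + z'"
  shows "x = x' \<and> y = y' \<and> z = z'"
proof -
  have "(x - x') *\<^sub>R A + (y - y') *\<^sub>R B + (z - z') *\<^sub>R C =
      (x *\<^sub>R A + y *\<^sub>R B + z *\<^sub>R C) - (x' *\<^sub>R A + y' *\<^sub>R B + z' *\<^sub>R C)"
    by (simp add: algebra_simps)
  then have "(x - x') *\<^sub>R A + (y - y') *\<^sub>R B + (z - z') *\<^sub>R C = 0"
    using assms(2) by simp
  moreover have "(x - x') + (y - y') + (z - z') = 0"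
    using assms(3) by simp
  ultimately show ?thesis
    using assms(1) unfolding affinely_independent3_def by (metis eq_iff_diff_eq_0)
qed

lemma affinely_independent3_distinct:
  assumes "affinely_independent3 A B C"
  shows "A \<noteq> B" "A \<noteq> C" "B \<noteq> C"
  using barycentric_unique[OF assms, of 1 0 0 0 1 0] barycentric_unique[OF assms, of 1 0 0 0 0 1]
    barycentric_unique[OF assms, of 0 1 0 0 0 1] by auto

lemma sides_meet_in_corner:
  assumes "affinely_independent3 A B C" "w \<in> closed_segment A B" "w \<in> closed_segment A C"
  shows "w = A"
proof -
  obtain s where s: "w = (1 - s) *\<^sub>R A + s *\<^sub>R B"
    using assms(2) unfolding closed_segment_def by blast
  obtain t where t: "w = (1 - t) *\<^sub>R A + t *\<^sub>R C"
    using assms(3) unfolding closed_segment_def by blast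
  have "1 - s = 1 - t \<and> s = 0 \<and> 0 = t"
    by (rule barycentric_unique[OF assms(1)]) (use s t in simp_all)
  then show ?thesis
    using s by simp
qed

lemma open_triangle_off_side:
  assumes "affinely_independent3 A B C"
  shows "open_triangle A B C \<inter> closed_segment A B = {}"
proof -
  have False if w: "w \<in> open_triangle A B C" "w \<in> closed_segment A B" for w
  proof -
    obtain x y z :: real where xyz: "0 < x" "0 < y" "0 < z" "x + y + z = 1" "w = x *\<^sub>R A + y *\<^sub>R B + z *\<^sub>R C"
      using w(1) unfolding open_triangle_def by blast
    obtain s where s: "w = (1 - s) *\<^sub>R A + s *\<^sub>R B"
      using w(2) unfolding closed_segment_def by blast
    have "x = 1 - s \<and> y = s \<and> z = 0"
      by (rule barycentric_unique[OF assms(1)]) (use s xyz in simp_all)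
    then show False
      using xyz by simp
  qed
  then show ?thesis
    by blast
qed

text \<open>
Along the spoke from \<open>A\<close> to the centroid the weights of \<open>B\<close> and \<open>C\<close> agree and grow from \<open>0\<close> to
\<open>1/3\<close>. How spokes and triangles intersect can be read off from these coordinates.
\<close>

lemma spoke_barycentric:
  assumes "w \<in> closed_segment A (centroid A B C)"
  obtains s where "0 \<le> s" "s \<le> 1/3" "w = (1 - 2 * s) *\<^sub>R A + s *\<^sub>R B + s *\<^sub>R C"
proof -
  obtain u where u: "0 \<le> u" "u \<le> 1" "w = (1 - u) *\<^sub>R A + u *\<^sub>R centroid A B C"
    using assms unfolding closed_segment_def by blast
  have "w = (1 - 2 * (u/3)) *\<^sub>R A + (u/3) *\<^sub>R B + (u/3) *\<^sub>R C"
  proof -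
    have "w = ((1 - u) *\<^sub>R A + (u/3) *\<^sub>R A) + (u/3) *\<^sub>R B + (u/3) *\<^sub>R C"
      using u(3) by (simp add: centroid_def scaleR_add_right add_ac)
    also have "(1 - u) *\<^sub>R A + (u/3) *\<^sub>R A = (1 - 2 * (u/3)) *\<^sub>R A"
      by (simp add: scaleR_add_left[symmetric])
    finally show ?thesis .
  qed
  then show ?thesis
    using that[of "u/3"] u by simp
qed

lemma centroid_in_open_triangle: "centroid A B C \<in> open_triangle A B C"
  unfolding centroid_def open_triangle_def by force

lemma spoke_in_open_triangle:
  assumes "w \<in> closed_segment A (centroid A B C)" "w \<noteq> A"
  shows "w \<in> open_triangle A B C"
proof -
  obtain s where s: "0 \<le> s" "s \<le> 1/3" "w = (1 - 2 * s) *\<^sub>R A + s *\<^sub>R B + s *\<^sub>R C"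
    using spoke_barycentric[OF assms(1)] .
  then have "s \<noteq> 0"
    using assms(2) by auto
  then show ?thesis
    unfolding open_triangle_def using s by (intro CollectI exI[of _ "1 - 2 * s"] exI[of _ s]) auto
qed

lemma spokes_meet_in_centroid:
  assumes "affinely_independent3 A B C"
    and "w \<in> closed_segment A (centroid A B C)" "w \<in> closed_segment B (centroid A B C)"
  shows "w = centroid A B C"
proof -
  obtain s where s: "w = (1 - 2 * s) *\<^sub>R A + s *\<^sub>R B + s *\<^sub>R C"
    using spoke_barycentric[OF assms(2)] by metis
  have "w \<in> closed_segment B (centroid B A C)"
    using assms(3) centroid_perm by metis
  then obtain t where t: "w = (1 - 2 * t) *\<^sub>R B + t *\<^sub>R A + t *\<^sub>R C"
    using spoke_barycentric by metis
  have "1 - 2 * s = t \<and> s = 1 - 2 * t \<and> s = t"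
    by (rule barycentric_unique[OF assms(1)]) (use s t in \<open>simp_all add: add_ac\<close>)
  then have third: "s = 1/3"
    by simp
  show ?thesis
    using s unfolding third by (simp add: centroid_def)
qed

lemma centroid_triangle_barycentric:
  assumes "w \<in> open_triangle A B (centroid A B C)"
  obtains x y z where "0 < x" "0 < y" "0 < z" "x + y + z = 1"
    "w = (x + z/3) *\<^sub>R A + (y + z/3) *\<^sub>R B + (z/3) *\<^sub>R C"
proof -
  obtain x y z where *: "0 < x" "0 < y" "0 < z" "x + y + z = 1"
    "w = x *\<^sub>R A + y *\<^sub>R B + z *\<^sub>R centroid A B C"
    using assms unfolding open_triangle_def by blast
  show ?thesis
    by (rule that[OF *(1-4)]) (simp add: *(5) centroid_def scaleR_add_right scaleR_add_left add_ac)
qed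

lemma centroid_triangle_subset: "open_triangle A B (centroid A B C) \<subseteq> open_triangle A B C"
proof
  fix w
  assume "w \<in> open_triangle A B (centroid A B C)"
  then obtain x y z where "0 < x" "0 < y" "0 < z" "x + y + z = 1"
    "w = (x + z/3) *\<^sub>R A + (y + z/3) *\<^sub>R B + (z/3) *\<^sub>R C"
    by (rule centroid_triangle_barycentric)
  then show "w \<in> open_triangle A B C"
    unfolding open_triangle_def
    by (intro CollectI exI[of _ "x + z/3"] exI[of _ "y + z/3"] exI[of _ "z/3"]) auto
qed

lemma centroid_triangle_off_spokes:
  assumes ind: "affinely_independent3 A B C" and w: "w \<in> open_triangle A B (centroid A B C)"
  shows "w \<notin> closed_segment A (centroid A B C)" "w \<notin> closed_segment B (centroid A B C)"
    "w \<notin> closed_segment C (centroid A B C)"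
proof -
  obtain x y z where c: "0 < x" "0 < y" "0 < z" "x + y + z = 1"
    "w = (x + z/3) *\<^sub>R A + (y + z/3) *\<^sub>R B + (z/3) *\<^sub>R C"
    using w by (rule centroid_triangle_barycentric)
  show "w \<notin> closed_segment A (centroid A B C)"
  proof
    assume "w \<in> closed_segment A (centroid A B C)"
    then obtain s where s: "w = (1 - 2 * s) *\<^sub>R A + s *\<^sub>R B + s *\<^sub>R C"
      using spoke_barycentric by metis
    have "x + z/3 = 1 - 2 * s \<and> y + z/3 = s \<and> z/3 = s"
      by (rule barycentric_unique[OF ind]) (use s c in simp_all)
    then show False
      using c by simp
  qed
  show "w \<notin> closed_segment B (centroid A B C)"
  proof
    assume "w \<in> closed_segment B (centroid A B C)"
    then have "w \<in> closed_segment B (centroid B A C)"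
      using centroid_perm by metis
    then obtain s where s: "w = (1 - 2 * s) *\<^sub>R B + s *\<^sub>R A + s *\<^sub>R C"
      using spoke_barycentric by metis
    have "x + z/3 = s \<and> y + z/3 = 1 - 2 * s \<and> z/3 = s"
      by (rule barycentric_unique[OF ind]) (use s c in \<open>simp_all add: add_ac\<close>)
    then show False
      using c by simp
  qed
  show "w \<notin> closed_segment C (centroid A B C)"
  proof
    assume "w \<in> closed_segment C (centroid A B C)"
    then have "w \<in> closed_segment C (centroid C A B)"
      using centroid_perm by metis
    then obtain s where s: "s \<le> 1/3" "w = (1 - 2 * s) *\<^sub>R C + s *\<^sub>R A + s *\<^sub>R B"
      using spoke_barycentric by metis
    have "x + z/3 = s \<and> y + z/3 = s \<and> z/3 = 1 - 2 * s"
      by (rule barycentric_unique[OF ind]) (use s c in \<open>simp_all add: add_ac\<close>)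
    then show False
      using c s by simp
  qed
qed

lemma affinely_independent3_centroid:
  assumes "affinely_independent3 A B C"
  shows "affinely_independent3 A B (centroid A B C)"
  unfolding affinely_independent3_def
proof (intro allI impI)
  fix x y z :: real
  assume *: "x + y + z = 0 \<and> x *\<^sub>R A + y *\<^sub>R B + z *\<^sub>R centroid A B C = 0"
  then have "(x + z/3) *\<^sub>R A + (y + z/3) *\<^sub>R B + (z/3) *\<^sub>R C = 0 *\<^sub>R A + 0 *\<^sub>R B + 0 *\<^sub>R C"
    by (simp add: centroid_def scaleR_add_right scaleR_add_left add_ac)
  then have "x + z/3 = 0 \<and> y + z/3 = 0 \<and> z/3 = 0"
    using * by (intro barycentric_unique[OF assms]) simp_all
  then show "x = 0 \<and> y = 0 \<and> z = 0"
    by simp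
qed

text \<open>
The edge \<open>e\<close> is the segment \<open>convex hull (p ` e)\<close>, which needs no choice of a first end.
\<close>

definition straight_drawing :: "'a set \<Rightarrow> 'a set set \<Rightarrow> ('a \<Rightarrow> complex) \<Rightarrow> bool" where
  "straight_drawing V Es p \<longleftrightarrow>
     inj_on p V \<and> (\<forall>e\<in>Es. e \<subseteq> V) \<and>
     (\<forall>e\<in>Es. convex hull (p ` e) \<inter> p ` V = p ` e) \<and>
     (\<forall>e\<in>Es. \<forall>f\<in>Es. e \<noteq> f \<longrightarrow> convex hull (p ` e) \<inter> convex hull (p ` f) \<subseteq> p ` (e \<inter> f))"

definition empty_face :: "'a set \<Rightarrow> 'a set set \<Rightarrow> ('a \<Rightarrow> complex) \<Rightarrow> 'a \<Rightarrow> 'a \<Rightarrow> 'a \<Rightarrow> bool" where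
  "empty_face V Es p a b c \<longleftrightarrow> {a, b, c} \<subseteq> V \<and>
     affinely_independent3 (p a) (p b) (p c) \<and>
     open_triangle (p a) (p b) (p c) \<inter> p ` V = {} \<and>
     (\<forall>e\<in>Es. open_triangle (p a) (p b) (p c) \<inter> convex hull (p ` e) = {})"

lemma empty_face_perm:
  "empty_face V Es p a b c \<Longrightarrow> empty_face V Es p b c a"
  "empty_face V Es p a b c \<Longrightarrow> empty_face V Es p b a c"
  unfolding empty_face_def
  using affinely_independent3_perm[of "p a" "p b" "p c"]
    open_triangle_perm[where A = "p a" and B = "p b" and C = "p c"] by auto

lemma straight_drawing_planar:
  fixes G :: "'a::linorder ugraph"
  assumes "simple_graph G" "straight_drawing (verts G) (edges G) p"
  shows "planar G"
proof -
  define \<gamma> where "\<gamma> e = linepath (p (Min e)) (p (Max e))" for e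
  have edge: "arc (\<gamma> e) \<and> {pathstart (\<gamma> e), pathfinish (\<gamma> e)} = p ` e \<and>
      path_image (\<gamma> e) = convex hull (p ` e)" if e: "e \<in> edges G" for e
  proof -
    have "card e = 2" "e \<subseteq> verts G"
      using assms(1) e unfolding simple_graph_def by auto
    then obtain u v where uv: "e = {u, v}" "u \<noteq> v"
      by (meson card_2_iff)
    have "\<exists>u v. e = {u, v} \<and> u < v"
      using uv by (metis insert_commute linorder_neqE)
    then obtain u v where uv: "e = {u, v}" "u < v"
      by blast
    then have g: "\<gamma> e = linepath (p u) (p v)"
      by (simp add: \<gamma>_def min_def max_def less_imp_le)
    have "p u \<noteq> p v"
      using assms(2) uv \<open>e \<subseteq> verts G\<close> unfolding straight_drawing_def
      by (metis inj_onD insertCI insert_subset less_irrefl)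
    then show ?thesis
      using g by (simp add: uv(1) segment_convex_hull)
  qed
  have "plane_drawing G p \<gamma>"
    unfolding plane_drawing_def using edge assms(2) unfolding straight_drawing_def by auto
  then show ?thesis
    unfolding planar_def by blast
qed

lemma straight_drawing_triangle:
  assumes ind: "affinely_independent3 (p a) (p b) (p c)"
  shows "straight_drawing {a, b, c} {{a, b}, {b, c}, {c, a}} p"
    "empty_face {a, b, c} {{a, b}, {b, c}, {c, a}} p a b c"
proof -
  define A B C where "A = p a" and "B = p b" and "C = p c"
  note rot = affinely_independent3_perm(1) and swap = affinely_independent3_perm(2)
  have i: "affinely_independent3 A B C" "affinely_independent3 B C A" "affinely_independent3 C A B"
    using ind rot[OF ind] rot[OF rot[OF ind]] unfolding A_def B_def C_def by simp_all
  have ne: "A \<noteq> B" "A \<noteq> C" "B \<noteq> C"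
    using affinely_independent3_distinct[OF i(1)] by simp_all
  have AB_CA: "closed_segment A B \<inter> closed_segment C A = {A}"
    unfolding closed_segment_commute[of C A] using sides_meet_in_corner[OF i(1)] by auto
  have BC_AB: "closed_segment B C \<inter> closed_segment A B = {B}"
    unfolding closed_segment_commute[of A B] using sides_meet_in_corner[OF i(2)] by auto
  have CA_BC: "closed_segment C A \<inter> closed_segment B C = {C}"
    unfolding closed_segment_commute[of B C] using sides_meet_in_corner[OF i(3)] by auto
  have opp: "C \<notin> closed_segment A B" "A \<notin> closed_segment B C" "B \<notin> closed_segment C A"
    using AB_CA BC_AB CA_BC ne by auto
  have T: "open_triangle A B C \<inter> closed_segment A B = {}"
    "open_triangle A B C \<inter> closed_segment B C = {}"
    "open_triangle A B C \<inter> closed_segment C A = {}"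
    using open_triangle_off_side[OF i(1)] open_triangle_off_side[OF i(2)]
      open_triangle_off_side[OF i(3)] open_triangle_perm(1)[of B C A]
      open_triangle_perm(1)[of C A B] by simp_all
  have dist: "a \<noteq> b" "a \<noteq> c" "b \<noteq> c"
    using ne unfolding A_def B_def C_def by auto
  have hull: "convex hull (p ` {a, b}) = closed_segment A B"
    "convex hull (p ` {b, c}) = closed_segment B C" "convex hull (p ` {c, a}) = closed_segment C A"
    unfolding A_def B_def C_def by (simp_all add: segment_convex_hull)
  have img: "p ` {a, b, c} = {A, B, C}" "p ` {a, b} = {A, B}" "p ` {b, c} = {B, C}"
    "p ` {c, a} = {C, A}" "p ` {a} = {A}" "p ` {b} = {B}" "p ` {c} = {C}"
    unfolding A_def B_def C_def by simp_all
  have Int: "{a, b} \<inter> {c, a} = {a}" "{c, a} \<inter> {a, b} = {a}" "{b, c} \<inter> {a, b} = {b}"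
    "{a, b} \<inter> {b, c} = {b}" "{c, a} \<inter> {b, c} = {c}" "{b, c} \<inter> {c, a} = {c}"
    using dist by auto
  show "straight_drawing {a, b, c} {{a, b}, {b, c}, {c, a}} p"
    unfolding straight_drawing_def
  proof (intro conjI)
    show "inj_on p {a, b, c}"
      using ne unfolding A_def B_def C_def inj_on_def by auto
    show "\<forall>e\<in>{{a, b}, {b, c}, {c, a}}. convex hull (p ` e) \<inter> p ` {a, b, c} = p ` e"
      unfolding ball_simps hull img(1) unfolding img using opp by auto
    have pairs: "\<forall>e\<in>{{a, b}, {b, c}, {c, a}}. \<forall>f\<in>{{a, b}, {b, c}, {c, a}}.
        e = f \<or> convex hull (p ` e) \<inter> convex hull (p ` f) = p ` (e \<inter> f)"
      unfolding ball_simps hull Int img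
      using AB_CA BC_AB CA_BC by (simp add: Int_commute segment_convex_hull)
    show "\<forall>e\<in>{{a, b}, {b, c}, {c, a}}. \<forall>f\<in>{{a, b}, {b, c}, {c, a}}.
        e \<noteq> f \<longrightarrow> convex hull (p ` e) \<inter> convex hull (p ` f) \<subseteq> p ` (e \<inter> f)"
    proof (intro ballI impI)
      fix e f
      assume e: "e \<in> {{a, b}, {b, c}, {c, a}}" and f: "f \<in> {{a, b}, {b, c}, {c, a}}" and ne: "e \<noteq> f"
      show "convex hull (p ` e) \<inter> convex hull (p ` f) \<subseteq> p ` (e \<inter> f)"
        using pairs[THEN bspec, OF e, THEN bspec, OF f] ne by blast
    qed
  qed auto
  have "open_triangle A B C \<inter> {A, B, C} = {}"
    using T by auto
  then show "empty_face {a, b, c} {{a, b}, {b, c}, {c, a}} p a b c"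
    unfolding empty_face_def ball_simps hull img(1)
    using T i(1) unfolding A_def B_def C_def by auto
qed

text \<open>
The new vertex \<open>n\<close> goes to the centroid of an empty face. The three new edges stay inside this face
except at its corners, so they cannot interfere with the old ones. The face \<open>abn\<close> is empty again,
which allows the next step; by symmetry any corner of the old face may play the part of \<open>c\<close>.
\<close>

lemma straight_drawing_stack:
  assumes D: "straight_drawing V Es p" and F: "empty_face V Es p a b c" and n: "n \<notin> V"
    and V': "V' = insert n V"
    and Es': "Es' = Es \<union> {{a, n}, {b, n}, {c, n}}"
  shows "\<exists>q. straight_drawing V' Es' q \<and> empty_face V' Es' q a b n"
proof -
  define A B C Z where "A = p a" and "B = p b" and "C = p c" and "Z = centroid A B C"
  define T where "T = open_triangle A B C"
  define q where "q = p(n := Z)"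
  have inj: "inj_on p V" and EsV: "\<And>e. e \<in> Es \<Longrightarrow> e \<subseteq> V"
    and ends: "\<And>e. e \<in> Es \<Longrightarrow> convex hull (p ` e) \<inter> p ` V = p ` e"
    and cross: "\<And>e f. e \<in> Es \<Longrightarrow> f \<in> Es \<Longrightarrow> e \<noteq> f \<Longrightarrow>
      convex hull (p ` e) \<inter> convex hull (p ` f) \<subseteq> p ` (e \<inter> f)"
    using D unfolding straight_drawing_def by simp_all
  have abc: "a \<in> V" "b \<in> V" "c \<in> V" and ind: "affinely_independent3 A B C"
    and TV: "T \<inter> p ` V = {}" and TE: "\<And>e. e \<in> Es \<Longrightarrow> T \<inter> convex hull (p ` e) = {}"
    using F unfolding empty_face_def A_def B_def C_def T_def by simp_all
  have ZT: "Z \<in> T"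
    unfolding Z_def T_def by (rule centroid_in_open_triangle)
  have qV: "q ` X = p ` X" if "X \<subseteq> V" for X
    unfolding q_def using n that by auto
  have qn: "q n = Z" "q a = A" "q b = B" "q c = C"
    using n abc unfolding q_def A_def B_def C_def by auto
  have qV': "q ` V' = insert Z (p ` V)"
    by (simp add: V' qn qV)
  note rot = affinely_independent3_perm(1) and swap = affinely_independent3_perm(2)
  have ind': "affinely_independent3 B C A" "affinely_independent3 C A B" "affinely_independent3 B A C"
    "affinely_independent3 C B A" "affinely_independent3 A C B"
    using ind rot[OF ind] rot[OF rot[OF ind]] swap[OF ind] swap[OF rot[OF ind]]
      swap[OF rot[OF rot[OF ind]]] by simp_all
  have cen: "centroid A B C = Z" "centroid B C A = Z" "centroid C A B = Z" "centroid B A C = Z"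
    "centroid C B A = Z" "centroid A C B = Z"
    unfolding Z_def centroid_def by (simp_all add: add_ac)
  have tri: "open_triangle B A C = T" "open_triangle C A B = T"
    unfolding T_def using open_triangle_perm(2)[of A B C] open_triangle_perm(1)[of B C A]
      open_triangle_perm(1)[of A B C] open_triangle_perm(1)[of C A B] by (metis, metis)
  have k_cases: "p k = A \<or> p k = B \<or> p k = C" if "k \<in> {a, b, c}" for k
    using that unfolding A_def B_def C_def by auto
  have spoke: "w \<in> T" if "w \<in> closed_segment (p k) Z" "k \<in> {a, b, c}" "w \<noteq> p k" for k w
    using k_cases[OF that(2)] that(1,3) spoke_in_open_triangle[of w A B C]
      spoke_in_open_triangle[of w B A C] spoke_in_open_triangle[of w C A B]
    by (auto simp: cen tri T_def[symmetric])
  have "p a \<noteq> p b" "p a \<noteq> p c" "p b \<noteq> p c"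
    using affinely_independent3_distinct[OF ind] unfolding A_def B_def C_def by simp_all
  then have spokes: "w = Z" if "w \<in> closed_segment (p k) Z" "w \<in> closed_segment (p l) Z"
    "k \<in> {a, b, c}" "l \<in> {a, b, c}" "k \<noteq> l" for k l w
    using k_cases[OF that(3)] k_cases[OF that(4)] that
      spokes_meet_in_centroid[OF ind, of w] spokes_meet_in_centroid[OF ind'(1), of w]
      spokes_meet_in_centroid[OF ind'(2), of w] spokes_meet_in_centroid[OF ind'(3), of w]
      spokes_meet_in_centroid[OF ind'(4), of w] spokes_meet_in_centroid[OF ind'(5), of w]
    unfolding cen by (auto simp: A_def B_def C_def)
  have new: "\<exists>k\<in>{a, b, c}. e = {k, n} \<and> convex hull (q ` e) = closed_segment (p k) Z"
    if "e \<in> Es'" "e \<notin> Es" for e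
    using that qn unfolding Es' A_def B_def C_def by (auto simp: segment_convex_hull)
  have old: "convex hull (q ` e) = convex hull (p ` e)" if "e \<in> Es" for e
    using qV[OF EsV[OF that]] by simp
  have k_mem: "k \<in> e" if "k \<in> {a, b, c}" "p k \<in> convex hull (p ` e)" "e \<in> Es" for k e
  proof -
    have "p k \<in> p ` e" "k \<in> V"
      using ends[OF that(3)] that abc by auto
    then show ?thesis
      using inj EsV[OF that(3)] by (auto dest: inj_onD)
  qed
  have mixed: "convex hull (q ` e) \<inter> convex hull (q ` f) \<subseteq> q ` (e \<inter> f)"
    if ef: "e \<in> Es'" "e \<notin> Es" "f \<in> Es" for e f
  proof
    fix w
    assume w: "w \<in> convex hull (q ` e) \<inter> convex hull (q ` f)"
    obtain k where k: "k \<in> {a, b, c}" "e = {k, n}" "convex hull (q ` e) = closed_segment (p k) Z"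
      using new ef by blast
    have "w = p k"
      using spoke[of w k] w k TE[OF ef(3)] old[OF ef(3)] by auto
    moreover have "k \<in> f"
      using k_mem[OF k(1) _ ef(3)] w old[OF ef(3)] calculation by auto
    moreover have "q k = p k"
      using k(1) abc n unfolding q_def by auto
    ultimately show "w \<in> q ` (e \<inter> f)"
      using k(2) by force
  qed
  have "straight_drawing V' Es' q"
    unfolding straight_drawing_def
  proof (intro conjI ballI impI)
    have "Z \<notin> p ` V"
      using TV ZT by blast
    then show "inj_on q V'"
      unfolding V' using n qV[of V] inj qn(1)
      by (auto simp: q_def inj_on_def)
  next
    fix e
    assume e: "e \<in> Es'"
    then show "e \<subseteq> V'"
      using EsV abc unfolding Es' V' by auto
    show "convex hull (q ` e) \<inter> q ` V' = q ` e"
    proof (cases "e \<in> Es")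
      case True
      then show ?thesis
        using old[OF True] ends[OF True] qV[OF EsV[OF True]] TE[OF True] ZT by (auto simp: qV')
    next
      case False
      obtain k where k: "k \<in> {a, b, c}" "e = {k, n}" "convex hull (q ` e) = closed_segment (p k) Z"
        using new[OF e False] by blast
      have "q ` e = {p k, Z}" "p k \<in> p ` V"
        using k qn abc unfolding A_def B_def C_def by auto
      moreover have "closed_segment (p k) Z \<inter> p ` V \<subseteq> {p k}"
        using spoke[OF _ k(1)] TV by blast
      ultimately show ?thesis
        unfolding k(3) qV' by auto
    qed
  next
    fix e f
    assume ef: "e \<in> Es'" "f \<in> Es'" "e \<noteq> f"
    consider "e \<in> Es" "f \<in> Es" | "e \<in> Es" "f \<notin> Es" | "e \<notin> Es" "f \<in> Es" | "e \<notin> Es" "f \<notin> Es"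
      by blast
    then show "convex hull (q ` e) \<inter> convex hull (q ` f) \<subseteq> q ` (e \<inter> f)"
    proof cases
      case 1
      then have "q ` (e \<inter> f) = p ` (e \<inter> f)"
        using EsV by (intro qV) blast
      then show ?thesis
        using cross[OF 1 ef(3)] old 1 by simp
    next
      case 2
      then show ?thesis
        using mixed[OF ef(2) _ 2(1)] by (simp add: Int_commute)
    next
      case 3
      then show ?thesis
        using mixed ef by blast
    next
      case 4
      obtain k where k: "k \<in> {a, b, c}" "e = {k, n}" "convex hull (q ` e) = closed_segment (p k) Z"
        using new[OF ef(1) 4(1)] by blast
      obtain l where l: "l \<in> {a, b, c}" "f = {l, n}" "convex hull (q ` f) = closed_segment (p l) Z"
        using new[OF ef(2) 4(2)] by blast
      have "k \<noteq> l"
        using k(2) l(2) ef(3) by blast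
      then have "convex hull (q ` e) \<inter> convex hull (q ` f) \<subseteq> {Z}"
        using spokes k l by blast
      then show ?thesis
        using k(2) l(2) qn(1) by auto
    qed
  qed
  moreover have "empty_face V' Es' q a b n"
    unfolding empty_face_def qn
  proof (intro conjI ballI)
    show "{a, b, n} \<subseteq> V'"
      using abc V' by blast
    show "affinely_independent3 A B Z"
      unfolding Z_def by (rule affinely_independent3_centroid[OF ind])
    (* The new face lies in the old one, and it misses the three new edges. *)
  have sub: "open_triangle A B Z \<subseteq> T"
      unfolding Z_def T_def by (rule centroid_triangle_subset)
    have off: "w \<notin> closed_segment (p k) Z" if "w \<in> open_triangle A B Z" "k \<in> {a, b, c}" for k w
      using that centroid_triangle_off_spokes[OF ind, of w] unfolding Z_def A_def B_def C_def by blast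
    show "open_triangle A B Z \<inter> q ` V' = {}"
      unfolding qV' using sub TV off[of Z a] by auto
    show "open_triangle A B Z \<inter> convex hull (q ` e) = {}" if e: "e \<in> Es'" for e
    proof (cases "e \<in> Es")
      case True
      then show ?thesis
        using old[OF True] TE[OF True] sub by blast
    next
      case False
      then show ?thesis
        using new[OF e False] off by blast
    qed
  qed
  ultimately show ?thesis
    by blast
qed

section \<open>Stacked triangulations are maximal planar\<close>

definition stacked_graph :: "(nat \<Rightarrow> nat set) \<Rightarrow> nat \<Rightarrow> nat ugraph" where
  "stacked_graph T n = \<lparr>verts = {..<n}, edges = {{u, v} | u v. v < n \<and> u \<in> T v}\<rparr>"

text \<open>
The set \<open>T v\<close> is the face into which \<open>v\<close> is placed; its corners are the neighbours of \<open>v\<close> among the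
smaller vertices. The next face has \<open>v\<close> as a corner in place of some old corner \<open>r\<close>. The vertices
\<open>0\<close>, \<open>1\<close>, \<open>2\<close> form the initial triangle, whence the exception for small \<open>v\<close>.
\<close>

definition stacking :: "(nat \<Rightarrow> nat set) \<Rightarrow> bool" where
  "stacking T \<longleftrightarrow> (\<forall>v\<le>3. T v = {..<v}) \<and>
     (\<forall>v\<ge>3. \<exists>r\<in>T v. T (Suc v) = insert v (T v - {r}))"

lemma stacking_step:
  assumes "stacking T" "3 \<le> v"
  obtains r where "r \<in> T v" "T (Suc v) = insert v (T v - {r})"
  using assms unfolding stacking_def by blast

lemma stacking_subset:
  assumes "stacking T"
  shows "T v \<subseteq> {..<v}"
proof (cases "v \<le> 3")
  case True
  then show ?thesis
    using assms unfolding stacking_def by blast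
next
  case False
  then have "3 \<le> v"
    by simp
  then show ?thesis
  proof (induction v rule: nat_induct_at_least)
    case base
    then show ?case
      using assms unfolding stacking_def by blast
  next
    case (Suc v)
    obtain r where "T (Suc v) = insert v (T v - {r})"
      using stacking_step[OF assms Suc.hyps] by blast
    then show ?case
      using Suc.IH by auto
  qed
qed

lemma stacking_clique:
  assumes "stacking T" "3 \<le> v" "x \<in> T v" "y \<in> T v" "x < y"
  shows "x \<in> T y"
  using assms(2-5)
proof (induction v rule: nat_induct_at_least)
  case base
  then have "y < 3" "T y = {..<y}"
    using assms(1) stacking_subset[OF assms(1), of 3] unfolding stacking_def by auto
  then show ?case
    using base by simp
next
  case (Suc v)
  obtain r where r: "T (Suc v) = insert v (T v - {r})"
    using stacking_step[OF assms(1) Suc.hyps] by blast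
  have "z < v" if "z \<in> T v" for z
    using stacking_subset[OF assms(1), of v] that by blast
  then show ?case
    using Suc r by (metis Diff_iff insert_iff less_asym)
qed

lemma stacking_card:
  assumes "stacking T" "3 \<le> v"
  shows "card (T v) = 3"
  using assms(2)
proof (induction v rule: nat_induct_at_least)
  case base
  then show ?case
    using assms(1) unfolding stacking_def by simp
next
  case (Suc v)
  obtain r where r: "r \<in> T v" "T (Suc v) = insert v (T v - {r})"
    using stacking_step[OF assms(1) Suc.hyps] by blast
  have "finite (T v)" "v \<notin> T v"
    using stacking_subset[OF assms(1), of v] finite_subset by auto
  then show ?case
    using r Suc by simp
qed

lemma stacked_graph_edge_iff:
  assumes "stacking T" "u < v"
  shows "{u, v} \<in> edges (stacked_graph T n) \<longleftrightarrow> v < n \<and> u \<in> T v"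
proof -
  have "x < y" if "x \<in> T y" for x y
    using stacking_subset[OF assms(1), of y] that by blast
  then show ?thesis
    using assms(2) unfolding stacked_graph_def by (auto simp: doubleton_eq_iff dest: less_asym)
qed

lemma simple_stacked_graph:
  assumes "stacking T"
  shows "simple_graph (stacked_graph T n)"
proof -
  have "x < y" if "x \<in> T y" for x y
    using stacking_subset[OF assms, of y] that by blast
  then show ?thesis
    unfolding simple_graph_def stacked_graph_def by (fastforce simp: card_2_iff)
qed

lemma stacked_graph_drawing:
  assumes T: "stacking T" and "3 \<le> n"
  shows "\<exists>p a b c. T n = {a, b, c} \<and>
    straight_drawing {..<n} (edges (stacked_graph T n)) p \<and>
    empty_face {..<n} (edges (stacked_graph T n)) p a b c"
  using assms(2)
proof (induction n rule: nat_induct_at_least)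
  case base
  have T3: "T 0 = {}" "T 1 = {0}" "T 2 = {0, 1}" "T 3 = {0, 1, 2}"
    using T unfolding stacking_def by auto
  have verts: "{..<3} = {0, 1, 2::nat}"
    by auto
  have "edges (stacked_graph T 3) = (\<Union>v\<in>{..<3}. (\<lambda>u. {u, v}) ` T v)"
    unfolding stacked_graph_def by auto
  also have "\<dots> = {{0, 1}, {1, 2}, {2, 0}}"
    unfolding verts by (simp add: T3[unfolded One_nat_def] insert_commute)
  finally have edges: "edges (stacked_graph T 3) = {{0, 1}, {1, 2}, {2, 0}}" .
  define p :: "nat \<Rightarrow> complex" where "p = (\<lambda>_. 0)(1 := 1, 2 := \<i>)"
  have "affinely_independent3 (p 0) (p 1) (p 2)"
    unfolding affinely_independent3_def p_def by (auto simp: complex_eq_iff)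
  from straight_drawing_triangle[of p 0 1 2, OF this] show ?case
    unfolding edges verts T3 by blast
next
  case (Suc n)
  then obtain p a b c where IH: "T n = {a, b, c}"
    "straight_drawing {..<n} (edges (stacked_graph T n)) p"
    "empty_face {..<n} (edges (stacked_graph T n)) p a b c"
    by blast
  obtain r where r: "r \<in> T n" "T (Suc n) = insert n (T n - {r})"
    using stacking_step[OF T Suc.hyps] by blast
  note rot = empty_face_perm(1)
  have "\<exists>x y. T n = {x, y, r} \<and> empty_face {..<n} (edges (stacked_graph T n)) p x y r"
    using r(1) IH(1) IH(3) rot[OF IH(3)] rot[OF rot[OF IH(3)]] by (auto simp: insert_commute)
  then obtain x y where xy: "T n = {x, y, r}"
    "empty_face {..<n} (edges (stacked_graph T n)) p x y r"
    by blast
  have "r \<noteq> x" "r \<noteq> y"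
    using affinely_independent3_distinct xy(2) unfolding empty_face_def by metis+
  then have "T (Suc n) = {x, y, n}"
    using r xy by auto
  moreover have "edges (stacked_graph T (Suc n)) =
      edges (stacked_graph T n) \<union> {{x, n}, {y, n}, {r, n}}"
    using xy(1) unfolding stacked_graph_def by (auto simp: less_Suc_eq)
  moreover have "n \<notin> {..<n}"
    by simp
  ultimately show ?case
    using straight_drawing_stack[OF IH(2) xy(2) _ lessThan_Suc] by metis
qed

lemma stacked_graph_planar:
  assumes "stacking T" "3 \<le> n"
  shows "planar (stacked_graph T n)"
proof -
  obtain p where "straight_drawing {..<n} (edges (stacked_graph T n)) p"
    using stacked_graph_drawing[OF assms] by blast
  then show ?thesis
    using straight_drawing_planar[OF simple_stacked_graph[OF assms(1)]]
    by (simp add: stacked_graph_def)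
qed

text \<open>
If \<open>u\<close> is not adjacent to \<open>v\<close>, then at some step \<open>k < v\<close> the vertex \<open>k\<close> replaced \<open>u\<close> as a corner of
the current face \<open>{u, x, y}\<close>. So \<open>u, x, y, k\<close> span a \<open>K\<^sub>4\<close>, and \<open>{k + 1, \<dots>, v}\<close> is connected and
adjacent to \<open>x, y, k\<close> through \<open>k + 1\<close>, and to \<open>u\<close> through the new edge.
\<close>

lemma stacked_graph_add_edge_not_planar:
  assumes T: "stacking T" and uv: "u < v" "v < n" "{u, v} \<notin> edges (stacked_graph T n)"
  shows "\<not> planar (add_edge u v (stacked_graph T n))"
proof
  define G where "G = add_edge u v (stacked_graph T n)"
  assume "planar (add_edge u v (stacked_graph T n))"
  then have planar: "planar G"
    unfolding G_def .
  have "u \<notin> T v"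
    using uv stacked_graph_edge_iff[OF T uv(1)] by blast
  then have v3: "3 < v"
    using T uv(1) unfolding stacking_def by (metis lessThan_iff not_less)
  (* From step max 3 (u + 1) on, u is a corner of the current face, until it is replaced. *)
  have start: "\<exists>m. 3 \<le> m \<and> u < m \<and> m \<le> v \<and> u \<in> T m"
  proof (cases "u < 3")
    case True
    then show ?thesis
      using T v3 unfolding stacking_def by (intro exI[of _ 3]) auto
  next
    case False
    then have "u \<in> T (Suc u)"
      using stacking_step[OF T, of u] by (metis insertI1 not_less)
    then show ?thesis
      using False uv(1) by (intro exI[of _ "Suc u"]) auto
  qed
  then obtain m where m: "3 \<le> m" "u < m" "m \<le> v" "u \<in> T m"
    by blast
  have "\<exists>k\<ge>m. k < v \<and> u \<in> T k \<and> u \<notin> T (Suc k)"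
  proof (rule ccontr)
    assume none: "\<not> ?thesis"
    have "j \<le> v \<Longrightarrow> u \<in> T j" if "m \<le> j" for j
      using that
    proof (induction j rule: nat_induct_at_least)
      case base
      then show ?case
        using m by simp
    next
      case (Suc j)
      then show ?case
        using none by (meson Suc_le_lessD less_imp_le)
    qed
    then show False
      using m(3) \<open>u \<notin> T v\<close> by blast
  qed
  then obtain k where k: "m \<le> k" "k < v" "u \<in> T k" "u \<notin> T (Suc k)"
    by blast
  have k3: "3 \<le> k" "u < k"
    using m k by auto
  obtain r where r: "r \<in> T k" "T (Suc k) = insert k (T k - {r})"
    using stacking_step[OF T k3(1)] by blast
  have "r = u"
    using r k by auto
  have fin: "finite (T k)" "T k \<subseteq> {..<k}"
    using stacking_subset[OF T, of k] finite_subset by auto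
  have "card (T k - {u}) = 2"
    using stacking_card[OF T k3(1)] k(3) by simp
  then obtain x y where xy: "T k - {u} = {x, y}" "x \<noteq> y"
    by (meson card_2_iff)
  have Tk: "T k = {u, x, y}" "x < k" "y < k" "u \<noteq> x" "u \<noteq> y"
    using xy(1) k(3) fin(2) by blast+
  have TSk: "T (Suc k) = {k, x, y}"
    using r xy \<open>r = u\<close> by simp
  have edge: "{i, j} \<in> edges G" if "i \<in> T j" "j < n" for i j
    using that unfolding G_def add_edge_def stacked_graph_def by auto
  have clique: "{i, j} \<in> edges G" if ij: "i \<in> T k" "j \<in> T k" "i \<noteq> j" for i j
  proof -
    have "j < n" "i < n"
      using ij fin(2) k(2) uv(2) by force+
    then show ?thesis
      using stacking_clique[OF T k3(1)] edge ij by (metis insert_commute linorder_neqE_nat)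
  qed
  have next_edge: "{j, Suc j} \<in> edges G" if "k \<le> j" "j < v" for j
    using stacking_step[OF T, of j] edge[of j "Suc j"] that k3 uv(2) by (metis insertI1
        le_trans less_trans_Suc not_less_eq order_less_le_trans Suc_leI)
  have adj_sym: "(i, j) \<in> adj_rel G \<inter> W \<times> W \<Longrightarrow> (j, i) \<in> adj_rel G \<inter> W \<times> W" for i j W
    by (auto simp: adj_rel_def insert_commute)
  let ?W = "{Suc k..v}"
  have up: "(Suc k, j) \<in> (adj_rel G \<inter> ?W \<times> ?W)\<^sup>*" if "Suc k \<le> j" "j \<le> v" for j
    using that
  proof (induction j rule: nat_induct_at_least)
    case base
    then show ?case
      by simp
  next
    case (Suc j)
    then have "(j, Suc j) \<in> adj_rel G \<inter> ?W \<times> ?W"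
      using next_edge[of j] by (auto simp: adj_rel_def)
    then show ?case
      using Suc by (meson Suc_leD rtrancl.rtrancl_into_rtrancl)
  qed
  have "sym ((adj_rel G \<inter> ?W \<times> ?W)\<^sup>*)"
    using adj_sym by (intro sym_rtrancl symI)
  then have W_conn: "(i, j) \<in> (adj_rel G \<inter> ?W \<times> ?W)\<^sup>*" if "i \<in> ?W" "j \<in> ?W" for i j
    using up[of i] up[of j] that by (meson atLeastAtMost_iff rtrancl_trans symD)
  show False
  proof (rule planar_no_K5_minor[OF _ planar, where a = u and b = x and c = y and d = k and W = ?W])
    show "simple_graph G"
      using simple_stacked_graph[OF T, of n] uv unfolding G_def add_edge_def simple_graph_def
      by (auto simp: stacked_graph_def)
    show "distinct [u, x, y, k]"
      using Tk xy k3 by auto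
    show "{u, x} \<in> edges G" "{u, y} \<in> edges G" "{x, y} \<in> edges G"
      using clique Tk xy by auto
    show "{u, k} \<in> edges G" "{x, k} \<in> edges G" "{y, k} \<in> edges G"
      using edge[of _ k] Tk k(2) uv(2) by auto
    show "?W \<subseteq> verts G" "?W \<noteq> {}"
      using uv k(2) unfolding G_def add_edge_def stacked_graph_def by auto
    show "?W \<inter> {u, x, y, k} = {}"
      using Tk k3 by auto
    show "\<exists>w\<in>?W. {w, z} \<in> edges G" if z: "z \<in> {u, x, y, k}" for z
    proof (cases "z = u")
      case True
      have "{v, u} \<in> edges G"
        unfolding G_def add_edge_def by (simp add: insert_commute)
      then show ?thesis
        using True k(2) by auto
    next
      case False
      then have "{z, Suc k} \<in> edges G"
        using edge[of z "Suc k"] z TSk k(2) uv(2) by auto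
      then show ?thesis
        using k(2) by (auto simp: insert_commute)
    qed
  qed (use W_conn in blast)
qed

theorem stacked_graph_maximal_planar:
  assumes "stacking T" "3 \<le> n"
  shows "maximal_planar (stacked_graph T n)"
  unfolding maximal_planar_def
proof (intro conjI ballI impI)
  show "simple_graph (stacked_graph T n)" "planar (stacked_graph T n)"
    using simple_stacked_graph stacked_graph_planar assms by auto
  fix u v
  assume uv: "u \<in> verts (stacked_graph T n)" "v \<in> verts (stacked_graph T n)"
    "u \<noteq> v \<and> {u, v} \<notin> edges (stacked_graph T n)"
  then have "u < n" "v < n"
    by (simp_all add: stacked_graph_def)
  consider "u < v" | "v < u"
    using uv(3) by linarith
  then show "\<not> planar (add_edge u v (stacked_graph T n))"
  proof cases
    case 1
    then show ?thesis
      using stacked_graph_add_edge_not_planar[OF assms(1) 1 \<open>v < n\<close>] uv by blast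
  next
    case 2
    have "add_edge u v (stacked_graph T n) = add_edge v u (stacked_graph T n)"
      by (simp add: add_edge_def insert_commute)
    then show ?thesis
      using stacked_graph_add_edge_not_planar[OF assms(1) 2 \<open>u < n\<close>] uv
      by (simp add: insert_commute)
  qed
qed

section \<open>Colourings of two stacked triangulations\<close>

text \<open>
The corners \<open>0\<close> and \<open>1\<close> are never replaced: this yields the join of the edge \<open>01\<close> and the path
\<open>2, 3, 4, \<dots>\<close>.
\<close>

definition double_fan :: "nat \<Rightarrow> nat set" where
  "double_fan v = {u. u < v \<and> (u < 2 \<or> v = Suc u)}"

text \<open>
The oldest corner is always replaced: vertices are adjacent when they differ by at most three.
\<close>

definition path_cube :: "nat \<Rightarrow> nat set" where
  "path_cube v = {u. u < v \<and> v \<le> u + 3}"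

lemma stacking_double_fan: "stacking double_fan"
proof -
  have "\<exists>r\<in>double_fan v. double_fan (Suc v) = insert v (double_fan v - {r})" if "3 \<le> v" for v
    using that by (intro bexI[of _ "v - 1"]) (auto simp: double_fan_def)
  moreover have "double_fan v = {..<v}" if "v \<le> 3" for v
    using that by (auto simp: double_fan_def)
  ultimately show ?thesis
    unfolding stacking_def by blast
qed

lemma stacking_path_cube: "stacking path_cube"
proof -
  have "\<exists>r\<in>path_cube v. path_cube (Suc v) = insert v (path_cube v - {r})" if "3 \<le> v" for v
    using that by (intro bexI[of _ "v - 3"]) (auto simp: path_cube_def)
  moreover have "path_cube v = {..<v}" if "v \<le> 3" for v
    using that by (auto simp: path_cube_def)
  ultimately show ?thesis
    unfolding stacking_def by blast
qed

text \<open>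
The colour of an edge may be prescribed as a function \<open>C\<close> of its smaller and its larger end, and the
size bound disappears, since the stacked graphs of all sizes have the same local
description.
\<close>

lemma unavoidable_stacked_copy:
  fixes H :: "'a ugraph" and C :: "nat \<Rightarrow> nat \<Rightarrow> colour"
  assumes T: "stacking T" and U: "unavoidable_pair H H maximal_planar_graphs"
  obtains f k where "inj_on f (verts H)"
    "\<And>u v. {u, v} \<in> edges H \<Longrightarrow>
      f u \<in> T (f v) \<and> C (f u) (f v) = k \<or> f v \<in> T (f u) \<and> C (f v) (f u) = k"
proof -
  obtain N where N: "\<And>G c. G \<in> maximal_planar_graphs \<Longrightarrow> card (verts G) \<ge> N \<Longrightarrow>
      contains_copy (colour_subgraph G c Red) H \<or> contains_copy (colour_subgraph G c Blue) H"
    using U unfolding unavoidable_pair_def by blast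
  define n where "n = max 3 N"
  define G where "G = stacked_graph T n"
  have "G \<in> maximal_planar_graphs" "card (verts G) \<ge> N"
    using stacked_graph_maximal_planar[OF T, of n]
    unfolding G_def maximal_planar_graphs_def by (simp_all add: n_def stacked_graph_def)
  then obtain k where "contains_copy (colour_subgraph G (\<lambda>e. C (Min e) (Max e)) k) H"
    using N by blast
  then obtain f where f: "inj_on f (verts H)"
    "\<And>e. e \<in> edges H \<Longrightarrow> f ` e \<in> edges G \<and> C (Min (f ` e)) (Max (f ` e)) = k"
    unfolding contains_copy_def colour_subgraph_def by auto
  show ?thesis
  proof (rule that[OF f(1)])
    fix u v
    assume "{u, v} \<in> edges H"
    then have uv: "{f u, f v} \<in> edges G" "C (Min {f u, f v}) (Max {f u, f v}) = k"
      using f(2)[of "{u, v}"] by auto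
    then obtain x y where xy: "{f u, f v} = {x, y}" "x \<in> T y"
      unfolding G_def stacked_graph_def by auto
    have "x < y"
      using stacking_subset[OF T, of y] xy(2) by blast
    then have "C x y = k"
      using uv(2) unfolding xy(1) by (simp add: min_def max_def)
    then show "f u \<in> T (f v) \<and> C (f u) (f v) = k \<or> f v \<in> T (f u) \<and> C (f v) (f u) = k"
      using xy by (auto simp: doubleton_eq_iff)
  qed
qed

text \<open>
Both blue components, the edge \<open>01\<close> and the path \<open>2, 3, 4, \<dots>\<close>, consist of edges between consecutive
numbers, so that a blue copy is a subgraph of one path.
\<close>

lemma unavoidable_biclique_or_path:
  fixes H :: "'a ugraph"
  assumes "unavoidable_pair H H maximal_planar_graphs" and "finite (verts H)"
    and V: "\<And>u v. {u, v} \<in> edges H \<Longrightarrow> u \<in> verts H \<and> v \<in> verts H"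
  shows "(\<exists>X\<subseteq>verts H. card X \<le> 2 \<and> (\<forall>u v. {u, v} \<in> edges H \<longrightarrow> (u \<in> X \<longleftrightarrow> v \<notin> X))) \<or>
    (\<exists>f :: 'a \<Rightarrow> nat. inj_on f (verts H) \<and>
      (\<forall>u v. {u, v} \<in> edges H \<longrightarrow> f v = Suc (f u) \<or> f u = Suc (f v)))"
proof -
  define C where "C x y = (if x < 2 \<and> 2 \<le> y then Red else Blue)" for x y :: nat
  obtain f k where f: "inj_on f (verts H)"
    "\<And>u v. {u, v} \<in> edges H \<Longrightarrow> f u \<in> double_fan (f v) \<and> C (f u) (f v) = k \<or>
      f v \<in> double_fan (f u) \<and> C (f v) (f u) = k"
    using unavoidable_stacked_copy[OF stacking_double_fan assms(1), where C = C] by blast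
  show ?thesis
  proof (cases k)
    case Red
    define X where "X = {v \<in> verts H. f v < 2}"
    have "card X \<le> card {..<2::nat}"
      using f(1) unfolding X_def by (intro card_inj_on_le[of f]) (auto simp: inj_on_def)
    moreover have "u \<in> X \<longleftrightarrow> v \<notin> X" if "{u, v} \<in> edges H" for u v
      using f(2)[OF that] V[OF that] Red unfolding X_def C_def by (auto split: if_splits)
    ultimately show ?thesis
      by (intro disjI1 exI[of _ X]) (auto simp: X_def)
  next
    case Blue
    have "f v = Suc (f u) \<or> f u = Suc (f v)" if "{u, v} \<in> edges H" for u v
      using f(2)[OF that] Blue unfolding C_def double_fan_def by (auto split: if_splits)
    then show ?thesis
      using f(1) by blast
  qed
qed

text \<open>
Each colour class consists of the edges at a centre (\<open>0\<close> for red, \<open>1\<close> for blue) and the edges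
\<open>{x, x + 1}\<close> whose smaller end \<open>x \<ge> 2\<close> has a fixed parity. The latter form a matching.
\<close>

lemma unavoidable_matching_plus_vertex:
  fixes H :: "'a ugraph"
  assumes "unavoidable_pair H H maximal_planar_graphs"
    and V: "\<And>u v. {u, v} \<in> edges H \<Longrightarrow> u \<in> verts H \<and> v \<in> verts H"
  shows "\<exists>z. \<forall>u v w. {u, v} \<in> edges H \<longrightarrow> {u, w} \<in> edges H \<longrightarrow> v \<noteq> w \<longrightarrow> z \<in> {u, v, w}"
proof -
  define C where "C x y = (if x = 0 \<or> 2 \<le> x \<and> even x then Red else Blue)" for x y :: nat
  obtain f k where f: "inj_on f (verts H)"
    "\<And>u v. {u, v} \<in> edges H \<Longrightarrow> f u \<in> double_fan (f v) \<and> C (f u) (f v) = k \<or>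
      f v \<in> double_fan (f u) \<and> C (f v) (f u) = k"
    using unavoidable_stacked_copy[OF stacking_double_fan assms(1), where C = C] by blast
  define centre where "centre = (if k = Red then 0 else 1 :: nat)"
  (* If no vertex of H is mapped to the centre, z is arbitrary, which does no harm:
     then all edges of H go to the matching. *)
  define z where "z = inv_into (verts H) f centre"
  (* Off the centre, the parity of f u decides on which side its only possible partner lies. *)
  have partner: "f v = (if (even (f u) \<longleftrightarrow> k = Red) then Suc (f u) else f u - 1)"
    if e: "{u, v} \<in> edges H" and c: "f u \<noteq> centre" "f v \<noteq> centre" for u v
    using f(2)[OF e] c unfolding C_def double_fan_def centre_def
    by (cases k) (auto split: if_splits)
  have at_centre: "v = z" if "v \<in> verts H" "f v = centre" for v
    using f(1) that unfolding z_def by (metis inv_into_f_f)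
  have "z \<in> {u, v, w}" if e: "{u, v} \<in> edges H" "{u, w} \<in> edges H" and "v \<noteq> w" for u v w
  proof (rule ccontr)
    assume "z \<notin> {u, v, w}"
    then have "f u \<noteq> centre" "f v \<noteq> centre" "f w \<noteq> centre"
      using at_centre V[OF e(1)] V[OF e(2)] by auto
    then have "f v = f w"
      using partner[OF e(1)] partner[OF e(2)] by simp
    then show False
      using f(1) V[OF e(1)] V[OF e(2)] \<open>v \<noteq> w\<close> by (meson inj_onD)
  qed
  then show ?thesis
    by blast
qed

text \<open>
The edges of length one are red and those of length two are blue, which gives each vertex at most two
of each. The edges of length three form three disjoint paths, one for each residue modulo three, and
alternate in colour along each of them, so each vertex gets at most one more of each colour.
\<close>

lemma unavoidable_max_degree:
  fixes H :: "'a ugraph"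
  assumes "unavoidable_pair H H maximal_planar_graphs"
    and V: "\<And>u v. {u, v} \<in> edges H \<Longrightarrow> u \<in> verts H \<and> v \<in> verts H"
  shows "card {v. {u, v} \<in> edges H} \<le> 3"
proof -
  define C where "C x y =
    (if y = x + 1 \<or> y = x + 3 \<and> even (x div 3) then Red else Blue)" for x y :: nat
  obtain f k where f: "inj_on f (verts H)"
    "\<And>u v. {u, v} \<in> edges H \<Longrightarrow> f u \<in> path_cube (f v) \<and> C (f u) (f v) = k \<or>
      f v \<in> path_cube (f u) \<and> C (f v) (f u) = k"
    using unavoidable_stacked_copy[OF stacking_path_cube assms(1), where C = C] by blast
  define d where "d = (if k = Red then 1 else 2 :: nat)"
  define S where "S = {f u + d, f u - d, if even (f u div 3) \<longleftrightarrow> k = Red then f u + 3 else f u - 3}"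
  have fS: "f v \<in> S" if e: "{u, v} \<in> edges H" for v
  proof -
    have "f v = f u + 1 \<or> f v = f u + 2 \<or> f v = f u + 3 \<or>
        f u = f v + 1 \<or> f u = f v + 2 \<or> f u = f v + 3"
      using f(2)[OF e] unfolding path_cube_def by auto
    then show ?thesis
      using f(2)[OF e] unfolding C_def path_cube_def S_def d_def
      by (cases k) (auto split: if_splits)
  qed
  have "card {v. {u, v} \<in> edges H} \<le> card S"
  proof (rule card_inj_on_le)
    show "inj_on f {v. {u, v} \<in> edges H}"
      by (rule inj_on_subset[OF f(1)]) (use V in auto)
    show "f ` {v. {u, v} \<in> edges H} \<subseteq> S"
      using fS by blast
  qed (simp add: S_def)
  also have "\<dots> \<le> 3"
    unfolding S_def by (simp add: card_insert_if)
  finally show ?thesis .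
qed

section \<open>Small trees from the three colourings\<close>

text \<open>
Three consecutive vertices of a cycle of length at least four contain two edges with a common end, so
\<open>z\<close> is one of them. The three vertices that follow \<open>z\<close> on the cycle, or any three if \<open>z\<close> is not on it,
contradict this. What remains are triangles, which are odd cycles.
\<close>

lemma acyclic_matching_plus_vertex:
  assumes bip: "\<And>u v. {u, v} \<in> edges H \<Longrightarrow> u \<in> S \<longleftrightarrow> v \<notin> S"
    and z: "\<And>u v w. {u, v} \<in> edges H \<Longrightarrow> {u, w} \<in> edges H \<Longrightarrow> v \<noteq> w \<Longrightarrow> z \<in> {u, v, w}"
  shows "\<not> is_cycle H c"
proof
  assume cyc: "is_cycle H c"
  define L where "L = length c"
  have L: "3 \<le> L" "distinct c" and edge: "\<And>i. i < L \<Longrightarrow> {c ! i, c ! (Suc i mod L)} \<in> edges H"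
    using cyc unfolding is_cycle_def L_def by auto
  show False
  proof (cases "L = 3")
    case True
    have "Suc 0 mod 3 = (1::nat)" "Suc 1 mod 3 = (2::nat)" "Suc 2 mod 3 = (0::nat)"
      by simp_all
    then have "{c ! 0, c ! 1} \<in> edges H" "{c ! 1, c ! 2} \<in> edges H" "{c ! 2, c ! 0} \<in> edges H"
      using edge[of 0] edge[of 1] edge[of 2] unfolding True by (simp_all add: numeral_2_eq_2)
    then show False
      using bip by blast
  next
    case False
    obtain j where j: "j < L" "z = c ! j \<or> z \<notin> set c"
      using L(1) unfolding L_def by (metis in_set_conv_nth less_le_trans zero_less_numeral)
    define i1 i2 i3 where "i1 = Suc j mod L" and "i2 = Suc i1 mod L" and "i3 = Suc i2 mod L"
    have lt: "i1 < L" "i2 < L" "i3 < L"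
      using L(1) unfolding i1_def i2_def i3_def by auto
    have ne: "j \<noteq> i1" "j \<noteq> i2" "j \<noteq> i3" "i1 \<noteq> i3"
      using L(1) False j(1) unfolding i1_def i2_def i3_def by (auto simp: mod_Suc split: if_splits)
    have "{c ! i2, c ! i1} \<in> edges H" "{c ! i2, c ! i3} \<in> edges H"
      using edge[OF lt(1)] edge[OF lt(2)] unfolding i2_def[symmetric] i3_def[symmetric]
      by (auto simp: insert_commute)
    moreover have "c ! i1 \<noteq> c ! i3"
      using L(2) lt ne unfolding L_def by (simp add: nth_eq_iff_index_eq)
    ultimately have "z \<in> {c ! i2, c ! i1, c ! i3}"
      using z by blast
    then show False
      using j L(2) lt ne unfolding L_def by (auto simp: nth_eq_iff_index_eq)
  qed
qed

text \<open>
A walk between two vertices changes \<open>f\<close> by one at each step and therefore uses an edge across every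
gap between intermediate values. So \<open>f\<close> maps the vertices onto an interval, and every pair of
consecutive numbers in this interval comes from an edge.
\<close>

lemma connected_in_path_is_path:
  fixes f :: "'a \<Rightarrow> nat"
  assumes H: "simple_graph H" "connected_graph H"
    and inj: "inj_on f (verts H)"
    and step: "\<And>u v. {u, v} \<in> edges H \<Longrightarrow> f v = Suc (f u) \<or> f u = Suc (f v)"
  shows "\<exists>g. bij_betw g (verts H) {..<card (verts H)} \<and>
    edges (path_graph (card (verts H))) = (\<lambda>e. g ` e) ` edges H"
proof -
  define V where "V = verts H"
  have fin: "finite V" "V \<noteq> {}"
    using H unfolding simple_graph_def connected_graph_def V_def by auto
  have pair: "\<exists>u v. e = {u, v} \<and> u \<in> V \<and> v \<in> V" if "e \<in> edges H" for e
  proof -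
    have "e \<subseteq> V" "card e = 2"
      using H(1) that unfolding simple_graph_def V_def by auto
    then show ?thesis
      by (metis card_2_iff insert_subset)
  qed
  have fill: "\<exists>p q. {p, q} \<in> edges H \<and> f p = t \<and> f q = Suc t"
    if "(u, v) \<in> (adj_rel H)\<^sup>*" "f u \<le> t" "t < f v" for u v t
    using that
  proof (induction rule: rtrancl_induct)
    case base
    then show ?case
      by simp
  next
    case (step v w)
    have e: "{v, w} \<in> edges H"
      using step.hyps(2) by (simp add: adj_rel_def)
    from assms(4)[OF e] show ?case
    proof
      assume "f w = Suc (f v)"
      then show ?thesis
        using step e by (cases "t = f v") auto
    next
      assume "f v = Suc (f w)"
      then show ?thesis
        using step by auto
    qed
  qed
  define a b where "a = Min (f ` V)" and "b = Max (f ` V)"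
  obtain u0 where u0: "u0 \<in> V" "f u0 = a"
  proof -
    have "Min (f ` V) \<in> f ` V"
      using fin by (intro Min_in) auto
    then show ?thesis
      using that unfolding a_def by auto
  qed
  obtain v0 where v0: "v0 \<in> V" "f v0 = b"
  proof -
    have "Max (f ` V) \<in> f ` V"
      using fin by (intro Max_in) auto
    then show ?thesis
      using that unfolding b_def by auto
  qed
  have bounds: "a \<le> f v" "f v \<le> b" if "v \<in> V" for v
    using that fin unfolding a_def b_def by simp_all
  have conn: "(u0, v0) \<in> (adj_rel H)\<^sup>*"
    using H(2) u0 v0 unfolding connected_graph_def V_def by blast
  have link: "\<exists>p q. {p, q} \<in> edges H \<and> f p = t \<and> f q = Suc t" if "a \<le> t" "t < b" for t
    using fill[OF conn] that u0 v0 by auto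
  have img: "f ` V = {a..b}"
  proof
    show "f ` V \<subseteq> {a..b}"
      using bounds by auto
    show "{a..b} \<subseteq> f ` V"
    proof
      fix t
      assume t: "t \<in> {a..b}"
      show "t \<in> f ` V"
      proof (cases "t = b")
        case True
        then show ?thesis
          using v0 by blast
      next
        case False
        then obtain p q where "{p, q} \<in> edges H" "f p = t"
          using link[of t] t by auto
        then show ?thesis
          using pair[of "{p, q}"] by (auto simp: doubleton_eq_iff)
      qed
    qed
  qed
  have "card V = card {a..b}"
    using card_image[OF inj[folded V_def]] img by simp
  then have card: "card V = Suc b - a"
    by simp
  have ab: "a \<le> b"
    using bounds[OF u0(1)] u0 by simp
  define g where "g v = f v - a" for v
  have "bij_betw (\<lambda>t. t - a) {a..b} {..<card V}"
    by (rule bij_betw_byWitness[where f' = "\<lambda>t. t + a"]) (use card ab in auto)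
  moreover have "bij_betw f V {a..b}"
    using inj img unfolding bij_betw_def V_def by simp
  ultimately have "bij_betw g V {..<card V}"
    using bij_betw_trans[of f V "{a..b}"] unfolding g_def comp_def by blast
  moreover have "edges (path_graph (card V)) = (\<lambda>e. g ` e) ` edges H"
  proof
    show "edges (path_graph (card V)) \<subseteq> (\<lambda>e. g ` e) ` edges H"
    proof
      fix e
      assume "e \<in> edges (path_graph (card V))"
      then obtain i where i: "e = {i, Suc i}" "Suc i < card V"
        unfolding path_graph_def by auto
      have "a + i < b"
        using i(2) card ab by linarith
      then obtain p q where pq: "{p, q} \<in> edges H" "f p = a + i" "f q = Suc (a + i)"
        using link[of "a + i"] by auto
      then have "e = g ` {p, q}"
        unfolding g_def i(1) by simp
      then show "e \<in> (\<lambda>e. g ` e) ` edges H"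
        using pq(1) by blast
    qed
    show "(\<lambda>e. g ` e) ` edges H \<subseteq> edges (path_graph (card V))"
    proof clarify
      fix e
      assume e: "e \<in> edges H"
      then obtain u v where uv: "e = {u, v}" "u \<in> V" "v \<in> V"
        using pair by blast
      have "g v = Suc (g u) \<or> g u = Suc (g v)"
        using step[of u v] e bounds[OF uv(2)] bounds[OF uv(3)] unfolding uv(1) g_def by auto
      moreover have "g u < card V" "g v < card V"
        using bounds[OF uv(2)] bounds[OF uv(3)] card ab unfolding g_def by auto
      ultimately show "g ` e \<in> edges (path_graph (card V))"
        unfolding path_graph_def uv(1) by (auto simp: insert_commute)
    qed
  qed
  ultimately show ?thesis
    unfolding V_def by blast
qed

text \<open>
On a path with at least six vertices, \<open>z\<close> would belong to the first three vertices and to the next three.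
\<close>

lemma path_matching_plus_vertex_short:
  assumes g: "bij_betw g (verts H) {..<m}" "edges (path_graph m) = (\<lambda>e. g ` e) ` edges H"
    and V: "\<And>e. e \<in> edges H \<Longrightarrow> e \<subseteq> verts H"
    and z: "\<And>u v w. {u, v} \<in> edges H \<Longrightarrow> {u, w} \<in> edges H \<Longrightarrow> v \<noteq> w \<Longrightarrow> z \<in> {u, v, w}"
  shows "m \<le> 5"
proof (rule ccontr)
  assume "\<not> m \<le> 5"
  then have m: "6 \<le> m"
    by simp
  define h where "h = inv_into (verts H) g"
  have inj: "inj_on g (verts H)"
    using g(1) by (simp add: bij_betw_def)
  have hV: "h i \<in> verts H" "g (h i) = i" if "i < m" for i
    using g(1) that unfolding h_def bij_betw_def by (auto intro: inv_into_into f_inv_into_f)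
  have link: "{h i, h (Suc i)} \<in> edges H" if "Suc i < m" for i
  proof -
    have "{i, Suc i} \<in> edges (path_graph m)"
      using that unfolding path_graph_def by auto
    then obtain e where e: "e \<in> edges H" "g ` e = {i, Suc i}"
      unfolding g(2) by auto
    have "g ` {h i, h (Suc i)} = g ` e"
      using hV[of i] hV[of "Suc i"] that e(2) by simp
    then have "{h i, h (Suc i)} = e"
      using inj_on_image_eq_iff[OF inj] V[OF e(1)] hV[of i] hV[of "Suc i"] that
      by (metis empty_subsetI insert_subset less_imp_le_nat Suc_lessD)
    then show ?thesis
      using e(1) by simp
  qed
  have ne: "h i \<noteq> h j" if "i < m" "j < m" "i \<noteq> j" for i j
    using hV that by metis
  have tri: "z \<in> {h (Suc i), h i, h (Suc (Suc i))}" if "Suc (Suc i) < m" for i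
    using z[of "h (Suc i)" "h i" "h (Suc (Suc i))"] link[of i] link[of "Suc i"] that
      ne[of i "Suc (Suc i)"] by (simp add: insert_commute)
  have "z \<in> h ` {0, 1, 2}" "z \<in> h ` {3, 4, 5}"
    using tri[of 0] tri[of 3] m by (auto simp: eval_nat_numeral)
  then show False
    using ne m by auto
qed

lemma graph_iso_path5:
  assumes "verts H = {a, b, c, d, e}" "distinct [a, b, c, d, e]"
    and "edges H = {{a, b}, {b, c}, {c, d}, {d, e}}"
  shows "graph_iso H (path_graph 5)"
proof -
  define f :: "'a \<Rightarrow> nat" where "f = (\<lambda>_. 0)(b := 1, c := 2, d := 3, e := 4)"
  have f: "f a = 0" "f b = 1" "f c = 2" "f d = 3" "f e = 4"
    using assms(2) unfolding f_def by auto
  have "{i. Suc i < 5} = {0, 1, 2, 3}"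
    by auto
  moreover have "edges (path_graph 5) = (\<lambda>i. {i, Suc i}) ` {i. Suc i < 5}"
    unfolding path_graph_def by (simp only: ugraph.simps setcompr_eq_image)
  ultimately have "edges (path_graph 5) = (\<lambda>i. {i, Suc i}) ` {0, 1, 2, 3}"
    by simp
  then have "edges (path_graph 5) = (\<lambda>x. f ` x) ` edges H"
    unfolding assms(3) by (simp add: f eval_nat_numeral)
  moreover have "bij_betw f (verts H) (verts (path_graph 5))"
  proof -
    have "{..<5} = {0, 1, 2, 3, 4::nat}"
      by auto
    then show ?thesis
      unfolding bij_betw_def assms(1) path_graph_def using f by (auto simp: inj_on_def)
  qed
  ultimately show ?thesis
    unfolding graph_iso_def by blast
qed

lemma graph_iso_fork:
  assumes "verts H = {x, a, b, w, y}" "distinct [x, a, b, w, y]"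
    and "edges H = {{x, a}, {x, b}, {x, w}, {w, y}}"
  shows "graph_iso H fork_graph"
proof -
  define f :: "'a \<Rightarrow> nat" where "f = (\<lambda>_. 0)(a := 1, b := 2, w := 3, y := 4)"
  have f: "f x = 0" "f a = 1" "f b = 2" "f w = 3" "f y = 4"
    using assms(2) unfolding f_def by auto
  have "edges fork_graph = (\<lambda>x. f ` x) ` edges H"
    unfolding assms(3) fork_graph_def by (simp add: f)
  moreover have "bij_betw f (verts H) (verts fork_graph)"
    unfolding bij_betw_def assms(1) fork_graph_def using f by (auto simp: inj_on_def)
  ultimately show ?thesis
    unfolding graph_iso_def by blast
qed

text \<open>
Apply the property of \<open>z\<close> to pairs of edges. A second common neighbour of \<open>x\<close> and \<open>y\<close> would create a
4-cycle, where no choice of \<open>z\<close> works. So, with \<open>w\<close> the common neighbour, \<open>H\<close> is determined by the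
sets \<open>A\<close> and \<open>B\<close> of the other neighbours of \<open>x\<close> and of \<open>y\<close>; each element of them is a leaf. If \<open>B\<close> is
empty, then \<open>A\<close> has exactly two elements by the degree bound, and \<open>H\<close> is the fork. If \<open>B\<close> is not
empty, two elements of \<open>A\<close> would force \<open>z = x\<close>, but the two edges at \<open>y\<close> avoid \<open>x\<close>. So \<open>A\<close> and \<open>B\<close>
are singletons, and \<open>H\<close> is a path.
\<close>

lemma path5_or_fork_of_two_centres:
  assumes V: "verts H = {x, y} \<union> Nx \<union> Ny"
    and Nx: "Nx = {v. {x, v} \<in> edges H}" and Ny: "Ny = {v. {y, v} \<in> edges H}"
    and disj: "x \<noteq> y" "x \<notin> Nx \<union> Ny" "y \<notin> Nx \<union> Ny"
    and E: "edges H = (\<lambda>v. {x, v}) ` Nx \<union> (\<lambda>v. {y, v}) ` Ny"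
    and fin: "finite Nx" "finite Ny" and deg: "card Nx \<le> 3"
    and common: "w \<in> Nx" "w \<in> Ny"
    and big: "5 \<le> card (verts H)" and le: "card Ny \<le> card Nx"
    and z: "\<And>u v w. {u, v} \<in> edges H \<Longrightarrow> {u, w} \<in> edges H \<Longrightarrow> v \<noteq> w \<Longrightarrow> z \<in> {u, v, w}"
  shows "graph_iso H (path_graph 5) \<or> graph_iso H fork_graph"
proof -
  have at_x: "z \<in> {x, v, v'}" if "v \<in> Nx" "v' \<in> Nx" "v \<noteq> v'" for v v'
    using z[of x v v'] that unfolding Nx by blast
  have at_y: "z \<in> {y, v, v'}" if "v \<in> Ny" "v' \<in> Ny" "v \<noteq> v'" for v v'
    using z[of y v v'] that unfolding Ny by blast
  have at_common: "z \<in> {v, x, y}" if "v \<in> Nx" "v \<in> Ny" for v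
    using z[of v x y] that disj(1) unfolding Nx Ny by (auto simp: insert_commute)
  have common': "v = w" if "v \<in> Nx" "v \<in> Ny" for v
    using at_x[of v w] at_y[of v w] at_common[of v] at_common[of w] that common disj by blast
  define A B where "A = Nx - {w}" and "B = Ny - {w}"
  have N: "Nx = insert w A" "Ny = insert w B" "w \<notin> A" "w \<notin> B" "finite A" "finite B"
    using common fin unfolding A_def B_def by auto
  have AB: "A \<inter> B = {}"
    using common' unfolding A_def B_def by auto
  have dw: "w \<noteq> x" "w \<noteq> y" "x \<notin> A" "x \<notin> B" "y \<notin> A" "y \<notin> B"
    using disj N by auto
  have VH: "verts H = insert x (insert y (insert w (A \<union> B)))"
    unfolding V N by auto
  have "card (verts H) = 3 + (card A + card B)"
    unfolding VH using dw disj(1) N AB by (simp add: card_Un_disjoint)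
  then have AB2: "2 \<le> card A + card B"
    using big by simp
  have A2: "card A \<le> 2" and BA: "card B \<le> card A"
    using deg le N by simp_all
  show ?thesis
  proof (cases "B = {}")
    case True
    then have "card A = 2"
      using AB2 A2 by simp
    then obtain a b where ab: "A = {a, b}" "a \<noteq> b"
      by (meson card_2_iff)
    have "graph_iso H fork_graph"
    proof (rule graph_iso_fork)
      show "verts H = {x, a, b, w, y}"
        unfolding VH ab True by auto
      show "distinct [x, a, b, w, y]"
        using dw disj(1) N ab by auto
      show "edges H = {{x, a}, {x, b}, {x, w}, {w, y}}"
        unfolding E N ab True by auto
    qed
    then show ?thesis ..
  next
    case False
    then obtain b where b: "b \<in> B"
      by blast
    have "a = a'" if "a \<in> A" "a' \<in> A" for a a'
    proof (rule ccontr)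
      assume "a \<noteq> a'"
      then have "z = x"
        using at_x[of a a'] at_x[of a w] at_x[of a' w] that N by auto
      then show False
        using at_y[of b w] b N dw disj(1) by auto
    qed
    moreover have "A \<noteq> {}"
      using AB2 BA by auto
    ultimately obtain a where a: "A = {a}"
      by blast
    then have "card B = 1"
      using False BA N(6) by (simp add: card_gt_0_iff le_antisym Suc_leI)
    then have B: "B = {b}"
      using b by (auto simp: card_1_singleton_iff)
    have "graph_iso H (path_graph 5)"
    proof (rule graph_iso_path5)
      show "verts H = {a, x, w, y, b}"
        unfolding VH a B by auto
      show "distinct [a, x, w, y, b]"
        using dw disj(1) N a B AB by auto
      show "edges H = {{a, x}, {x, w}, {w, y}, {y, b}}"
        unfolding E N a B by auto
    qed
    then show ?thesis ..
  qed
qed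

text \<open>
If \<open>X\<close> had at most one element, then \<open>H\<close> would be a star or have no edges, too small for five vertices by the degree
bound. If \<open>X = {x, y}\<close>, connectedness gives a common neighbour, since otherwise
\<open>x\<close> and its neighbours would be closed under adjacency.
\<close>

lemma path5_or_fork_of_biclique:
  assumes H: "simple_graph H" "connected_graph H" and big: "5 \<le> card (verts H)"
    and X: "X \<subseteq> verts H" "card X \<le> 2" "\<And>u v. {u, v} \<in> edges H \<Longrightarrow> u \<in> X \<longleftrightarrow> v \<notin> X"
    and deg: "\<And>u. card {v. {u, v} \<in> edges H} \<le> 3"
    and z: "\<And>u v w. {u, v} \<in> edges H \<Longrightarrow> {u, w} \<in> edges H \<Longrightarrow> v \<noteq> w \<Longrightarrow> z \<in> {u, v, w}"
  shows "graph_iso H (path_graph 5) \<or> graph_iso H fork_graph"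
proof -
  define N where "N u = {v. {u, v} \<in> edges H}" for u
  have fin: "finite (verts H)"
    using H(1) unfolding simple_graph_def by blast
  have ends: "u \<in> verts H" "v \<in> verts H" if "{u, v} \<in> edges H" for u v
    using H(1) that unfolding simple_graph_def by auto
  have NV: "N u \<subseteq> verts H" for u
    using ends unfolding N_def by blast
  have finN: "finite (N u)" for u
    using NV fin finite_subset by blast
  have nbr: "\<exists>v. {u, v} \<in> edges H" if u: "u \<in> verts H" for u
  proof -
    have "verts H \<noteq> {u}"
      using big by auto
    then obtain v where "v \<in> verts H" "v \<noteq> u"
      using u by blast
    then have "(u, v) \<in> (adj_rel H)\<^sup>*" "u \<noteq> v"
      using H(2) \<open>u \<in> verts H\<close> unfolding connected_graph_def by auto
    then show ?thesis
      by (metis (no_types, lifting) adj_rel_def case_prodD converse_rtranclE mem_Collect_eq)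
  qed
  have cover: "verts H = X \<union> (\<Union>x\<in>X. N x)"
  proof
    show "verts H \<subseteq> X \<union> (\<Union>x\<in>X. N x)"
    proof
      fix u
      assume "u \<in> verts H"
      then obtain v where "{u, v} \<in> edges H"
        using nbr by blast
      then show "u \<in> X \<union> (\<Union>x\<in>X. N x)"
        using X(3)[of u v] unfolding N_def by (auto simp: insert_commute)
    qed
  qed (use X NV in blast)
  have "finite X"
    using X(1) fin finite_subset by blast
  have "card X = 2"
  proof (rule ccontr)
    assume "card X \<noteq> 2"
    then consider "card X = 0" | "card X = 1"
      using X(2) by linarith
    then show False
    proof cases
      case 1
      then show False
        using cover big \<open>finite X\<close> by simp
    next
      case 2
      then obtain x where "X = {x}"
        by (meson card_1_singletonE)
      then have "card (verts H) \<le> Suc (card (N x))"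
        unfolding cover by (simp add: card_insert_le_m1 card_insert_if finN)
      then show False
        using big deg[of x] unfolding N_def by simp
    qed
  qed
  then obtain x y where xy: "X = {x, y}" "x \<noteq> y"
    by (meson card_2_iff)
  have V: "verts H = {x, y} \<union> N x \<union> N y"
    using cover xy by auto
  have disj: "x \<notin> N x \<union> N y" "y \<notin> N x \<union> N y"
    using X(3)[of x x] X(3)[of x y] X(3)[of y x] X(3)[of y y] xy unfolding N_def by auto
  have E: "edges H = (\<lambda>v. {x, v}) ` N x \<union> (\<lambda>v. {y, v}) ` N y"
  proof
    show "edges H \<subseteq> (\<lambda>v. {x, v}) ` N x \<union> (\<lambda>v. {y, v}) ` N y"
    proof
      fix e
      assume e: "e \<in> edges H"
      then have "card e = 2"
        using H(1) unfolding simple_graph_def by blast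
      then obtain u v where uv: "e = {u, v}"
        by (meson card_2_iff)
      then have "u \<in> X \<or> v \<in> X"
        using X(3) e by blast
      then obtain s t where "e = {s, t}" "s = x \<or> s = y"
        using uv xy(1) by (auto simp: insert_commute)
      then show "e \<in> (\<lambda>v. {x, v}) ` N x \<union> (\<lambda>v. {y, v}) ` N y"
        using e unfolding N_def by auto
    qed
  qed (auto simp: N_def)
  have "\<exists>w. w \<in> N x \<and> w \<in> N y"
  proof (rule ccontr)
    assume none: "\<nexists>w. w \<in> N x \<and> w \<in> N y"
    have "(x, y) \<in> (adj_rel H)\<^sup>*"
      using H(2) V unfolding connected_graph_def by blast
    then have "y \<in> insert x (N x)"
    proof (induction rule: rtrancl_induct)
      case (step u v)
      then have "{u, v} \<in> edges H"
        by (simp add: adj_rel_def)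
      then show ?case
        using step.IH X(3)[of u v] X(3)[of x u] none xy unfolding N_def by (auto simp: insert_commute)
    qed simp
    then show False
      using xy disj by blast
  qed
  then obtain w where w: "w \<in> N x" "w \<in> N y"
    by blast
  show ?thesis
  proof (cases "card (N y) \<le> card (N x)")
    case True
    show ?thesis
      by (rule path5_or_fork_of_two_centres[OF V N_def N_def xy(2) disj E finN finN _ w big True z])
         (use deg N_def in auto)
  next
    case False
    have V': "verts H = {y, x} \<union> N y \<union> N x"
      using V by auto
    have E': "edges H = (\<lambda>v. {y, v}) ` N y \<union> (\<lambda>v. {x, v}) ` N x"
      using E by blast
    show ?thesis
      by (rule path5_or_fork_of_two_centres[OF V' N_def N_def _ _ _ E' finN finN _ w(2,1) big _ z])
         (use deg N_def xy disj False in auto)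
  qed
qed

theorem theorem2:
  fixes H :: "'a ugraph"
  assumes "simple_graph H"
    and "connected_graph H"
    and "unavoidable_pair H H maximal_planar_graphs"
  shows "(is_tree H \<and> card (verts H) \<le> 4) \<or>
         graph_iso H (path_graph 5) \<or>
         graph_iso H fork_graph"
proof -
  have fin: "finite (verts H)" and EV: "\<And>e. e \<in> edges H \<Longrightarrow> e \<subseteq> verts H"
    using assms(1) unfolding simple_graph_def by auto
  then have ends: "u \<in> verts H \<and> v \<in> verts H" if "{u, v} \<in> edges H" for u v
    using that by blast
  obtain z where z: "\<And>u v w. {u, v} \<in> edges H \<Longrightarrow> {u, w} \<in> edges H \<Longrightarrow> v \<noteq> w \<Longrightarrow> z \<in> {u, v, w}"
    using unavoidable_matching_plus_vertex[OF assms(3) ends] by metis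
  have deg: "card {v. {u, v} \<in> edges H} \<le> 3" for u
    using unavoidable_max_degree[OF assms(3) ends] .
  consider (biclique) X where "X \<subseteq> verts H" "card X \<le> 2"
      "\<And>u v. {u, v} \<in> edges H \<Longrightarrow> u \<in> X \<longleftrightarrow> v \<notin> X"
    | (path) f :: "'a \<Rightarrow> nat" where "inj_on f (verts H)"
      "\<And>u v. {u, v} \<in> edges H \<Longrightarrow> f v = Suc (f u) \<or> f u = Suc (f v)"
    using unavoidable_biclique_or_path[OF assms(3) fin ends] by metis
  then show ?thesis
  proof cases
    case biclique
    have "is_tree H"
      unfolding is_tree_def
      using assms acyclic_matching_plus_vertex[of H X z] biclique(3) z by blast
    then show ?thesis
      using path5_or_fork_of_biclique[OF assms(1,2) _ biclique deg z] by linarith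
  next
    case path
    have "u \<in> {v. even (f v)} \<longleftrightarrow> v \<notin> {v. even (f v)}" if "{u, v} \<in> edges H" for u v
      using path(2)[OF that] by auto
    then have tree: "is_tree H"
      unfolding is_tree_def
      using assms acyclic_matching_plus_vertex[of H "{v. even (f v)}" z] z by blast
    obtain g where g: "bij_betw g (verts H) {..<card (verts H)}"
      "edges (path_graph (card (verts H))) = (\<lambda>e. g ` e) ` edges H"
      using connected_in_path_is_path[OF assms(1,2) path] by blast
    have "card (verts H) \<le> 5"
      using path_matching_plus_vertex_short[OF g EV z] .
    moreover have "graph_iso H (path_graph 5)" if "card (verts H) = 5"
      using g unfolding that graph_iso_def by (auto simp: path_graph_def)
    ultimately show ?thesis
      using tree by linarith
  qed
qed

end
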